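(* Let $X$ be a compact Hausdorff space. Let $\mathcal{S}C(X)$ be the state space of the C*-algebra $C(X)$ with the weak* topology, identified with the space of regular Borel probability measures on $X$. For a nonempty closed subset $K\subseteq X$ let $\mathcal{F}_K:=\{\mu\in\mathcal{S}C(X):\operatorname{supp}(\mu)\subseteq K\}$. Then the map $\mathcal{F}:K\mapsto\mathcal{F}_K$ is a homeomorphism from the hyperspace $\mathfrak{S}_{\mathrm{cl}}X$ onto a closed subspace of the hyperspace $\mathfrak{S}_{\mathrm{cl}}\,\mathcal{S}C(X)$, where both hyperspaces carry the Vietoris topology.
   Context: $C(X)$ is the C*-algebra of complex-valued continuous functions on $X$. For a compact Hausdorff space $Y$, $\mathfrak{S}_{\mathrm{cl}}Y$ denotes the set of all nonempty closed subsets of $Y$. For open $U\subseteq Y$ put $U^-:=\{K\in\mathfrak{S}_{\mathrm{cl}}Y:K\cap U\neq\emptyset\}$ and $U^+:=\{K\in\mathfrak{S}_{\mathrm{cl}}Y:K\subseteq U\}$. The Vietoris topology on $\mathfrak{S}_{\mathrm{cl}}Y$ is the smallest topology containing all the sets $U^+$ and $U^-$, for $U$ open in $Y$; $\mathfrak{S}_{\mathrm{cl}}Y$ with this topology is called the hyperspace of closed sets in $Y$. The set $\mathcal{S}C(X)$ with the weak* topology is a compact Hausdorff space and each $\mathcal{F}_K$ is a nonempty weak*-closed subset (indeed a face) of it. *)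

theory Defs
  imports "HOL-Probability.Probability"
begin

definition closed_subsets :: "'a topology \<Rightarrow> 'a set set" where
  "closed_subsets Y = {K. closedin Y K \<and> K \<noteq> {}}"

definition vietoris_minus :: "'a topology \<Rightarrow> 'a set \<Rightarrow> 'a set set" where
  "vietoris_minus Y U = {K \<in> closed_subsets Y. K \<inter> U \<noteq> {}}"

definition vietoris_plus :: "'a topology \<Rightarrow> 'a set \<Rightarrow> 'a set set" where
  "vietoris_plus Y U = {K \<in> closed_subsets Y. K \<subseteq> U}"

definition hyperspace :: "'a topology \<Rightarrow> 'a set topology" where
  "hyperspace Y =
     topology_generated_by (vietoris_minus Y ` {U. openin Y U} \<union> vietoris_plus Y ` {U. openin Y U})"

lemma topspace_hyperspace: "topspace (hyperspace Y) = closed_subsets Y"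
proof -
  have "closed_subsets Y = vietoris_plus Y (topspace Y)"
    by (auto simp: closed_subsets_def vietoris_plus_def dest: closedin_subset)
  moreover have "vietoris_plus Y U \<subseteq> closed_subsets Y" "vietoris_minus Y U \<subseteq> closed_subsets Y" for U
    by (auto simp: vietoris_plus_def vietoris_minus_def)
  ultimately show ?thesis
    unfolding hyperspace_def topology_generated_by_topspace by blast
qed

text \<open>
  The underlying set of $C(X)$. Functions live on the whole type, so they are normalised to
  \<^const>\<open>undefined\<close> outside the space; this makes equality in $C(X)$ coincide with equality in HOL.
\<close>

definition cfunspace :: "'a topology \<Rightarrow> ('a \<Rightarrow> complex) set" where
  "cfunspace X = {f \<in> extensional (topspace X). continuous_map X euclidean f}"

definition clinear_functional :: "'a topology \<Rightarrow> (('a \<Rightarrow> complex) \<Rightarrow> complex) \<Rightarrow> bool" where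
  "clinear_functional X \<phi> \<longleftrightarrow>
     (\<forall>f\<in>cfunspace X. \<forall>g\<in>cfunspace X. \<phi> (\<lambda>x\<in>topspace X. f x + g x) = \<phi> f + \<phi> g) \<and>
     (\<forall>c. \<forall>f\<in>cfunspace X. \<phi> (\<lambda>x\<in>topspace X. c * f x) = c * \<phi> f)"

definition positive_functional :: "'a topology \<Rightarrow> (('a \<Rightarrow> complex) \<Rightarrow> complex) \<Rightarrow> bool" where
  "positive_functional X \<phi> \<longleftrightarrow>
     (\<forall>f\<in>cfunspace X. \<phi> (\<lambda>x\<in>topspace X. cnj (f x) * f x) \<in> \<real>\<^sub>\<ge>\<^sub>0)"

definition unit_ball_values :: "'a topology \<Rightarrow> (('a \<Rightarrow> complex) \<Rightarrow> complex) \<Rightarrow> real set" where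
  "unit_ball_values X \<phi> = {cmod (\<phi> f) |f. f \<in> cfunspace X \<and> (\<forall>x\<in>topspace X. cmod (f x) \<le> 1)}"

text \<open>
  Boundedness is stated separately because \<^const>\<open>Sup\<close> on the reals is only meaningful for sets
  that are bounded above; the supremum is then the norm of the functional.
\<close>

definition states :: "'a topology \<Rightarrow> (('a \<Rightarrow> complex) \<Rightarrow> complex) set" where
  "states X = {\<phi> \<in> extensional (cfunspace X).
     clinear_functional X \<phi> \<and> positive_functional X \<phi> \<and>
     bdd_above (unit_ball_values X \<phi>) \<and> Sup (unit_ball_values X \<phi>) = 1}"

text \<open>
  The weak* topology is the topology of pointwise convergence on $C(X)$, i.e. the one inherited
  from the product of copies of the complex plane indexed by $C(X)$.
\<close>

definition state_space :: "'a topology \<Rightarrow> (('a \<Rightarrow> complex) \<Rightarrow> complex) topology" where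
  "state_space X = subtopology (product_topology (\<lambda>_. euclidean) (cfunspace X)) (states X)"

lemma topspace_state_space: "topspace (state_space X) = states X"
  by (auto simp: state_space_def states_def PiE_def)

definition regular_borel_probs :: "'a topology \<Rightarrow> 'a measure set" where
  "regular_borel_probs X = {M. prob_space M \<and>
     sets M = sets (sigma (topspace X) {U. openin X U}) \<and>
     (\<forall>A\<in>sets M. emeasure M A = (INF U\<in>{U. openin X U \<and> A \<subseteq> U}. emeasure M U)) \<and>
     (\<forall>A\<in>sets M. emeasure M A = (SUP C\<in>{C. compactin X C \<and> C \<subseteq> A}. emeasure M C))}"

definition supp :: "'a topology \<Rightarrow> 'a measure \<Rightarrow> 'a set" where
  "supp X M = {x \<in> topspace X. \<forall>U. openin X U \<and> x \<in> U \<longrightarrow> emeasure M U > 0}"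

definition represents :: "'a topology \<Rightarrow> 'a measure \<Rightarrow> (('a \<Rightarrow> complex) \<Rightarrow> complex) \<Rightarrow> bool" where
  "represents X M \<phi> \<longleftrightarrow>
     M \<in> regular_borel_probs X \<and> (\<forall>f\<in>cfunspace X. \<phi> f = integral\<^sup>L M f)"

text \<open>
  States are identified with regular Borel probability measures by the Riesz representation
  theorem: on a compact Hausdorff space every state is represented by exactly one such measure,
  so the existential quantifier below refers to the measure of the state.
\<close>

definition face :: "'a topology \<Rightarrow> 'a set \<Rightarrow> (('a \<Rightarrow> complex) \<Rightarrow> complex) set" where
  "face X K = {\<phi> \<in> states X. \<exists>M. represents X M \<phi> \<and> supp X M \<subseteq> K}"

end

theory Submission
  imports Defs
begin

text \<open>
  The hyperspace of a compact space is compact (\<open>compact_space_hyperspace\<close>), and the hyperspace of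
  a compact Hausdorff space is Hausdorff (\<open>Hausdorff_space_hyperspace\<close>). The state space is compact
  Hausdorff, so the face map goes from a compact space to a Hausdorff space, and it is enough to
  show that it is well defined, injective and continuous: it is then a closed embedding.

  Everything rests on the description \<open>face_eq\<close>: a state lies in the face of \<open>K\<close> if and only if it
  vanishes on all nonnegative continuous functions that vanish on \<open>K\<close>. This condition is weak*
  closed, so faces are points of the hyperspace. That it is sufficient requires a measure for
  every state, that is, the existence part of the Riesz representation theorem with a regular
  measure. It is proved here for normalised positive functionals on a compact Hausdorff space,
  by Caratheodory's method applied to the outer measure that is determined by the values of the
  functional on functions between \<open>0\<close> and the indicator of an open set (\<open>riesz_representation\<close>).

  Injectivity holds because the evaluation at \<open>x\<close> is in the face of \<open>K\<close> exactly if \<open>x\<close> is in \<open>K\<close>.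
  Continuity is tested on the two kinds of subbasic sets. For \<open>U\<^sup>+\<close>, compactness of the set of
  states outside \<open>U\<close> gives an open \<open>V\<close> around \<open>K\<close> such that all states supported in \<open>V\<close> are in \<open>U\<close>
  (\<open>face_subset_open_nbhd\<close>). For \<open>U\<^sup>-\<close>, a state of \<open>K\<close> that lies in \<open>U\<close> is approximated by moving
  its mass to finitely many points of any closed set \<open>L\<close> close enough to \<open>K\<close>
  (\<open>face_meets_open_nbhd\<close>).
\<close>

section \<open>The Vietoris topology\<close>

lemma compactin_finite_subcover:
  assumes K: "compactin X K" and U: "\<And>i. i \<in> A \<Longrightarrow> openin X (U i)" and cov: "K \<subseteq> (\<Union>i\<in>A. U i)"
  shows "\<exists>D. finite D \<and> D \<subseteq> A \<and> K \<subseteq> (\<Union>i\<in>D. U i)"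
proof -
  have "\<exists>\<F>. finite \<F> \<and> \<F> \<subseteq> U ` A \<and> K \<subseteq> \<Union>\<F>"
    using U cov by (intro compactinD[OF K]) auto
  then obtain \<F> where \<F>: "finite \<F>" "\<F> \<subseteq> U ` A" "K \<subseteq> \<Union>\<F>" by blast
  then obtain D where "D \<subseteq> A" "finite D" "\<F> = U ` D"
    using finite_subset_image[OF \<F>(1,2)] by blast
  then show ?thesis using \<F>(3) by blast
qed

lemma openin_hyperspace_plus: "openin Y U \<Longrightarrow> openin (hyperspace Y) (vietoris_plus Y U)"
  and openin_hyperspace_minus: "openin Y U \<Longrightarrow> openin (hyperspace Y) (vietoris_minus Y U)"
  unfolding hyperspace_def by (auto intro!: topology_generated_by_Basis)

lemma topology_generated_by_eq_subbase:
  "topology (arbitrary union_of (finite intersection_of (\<lambda>x. x \<in> \<B>) relative_to \<Union>\<B>)) =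
    topology_generated_by \<B>" (is "?T = _")
  unfolding topology_eq
proof (intro allI iffI)
  fix S assume "openin ?T S"
  moreover have "openin (topology_generated_by \<B>) A" if "A \<in> \<B>" for A
    using that by (rule topology_generated_by_Basis)
  ultimately show "openin (topology_generated_by \<B>) S"
    by (elim minimal_topology_subbase[rotated 2]) blast+
next
  fix S assume "openin (topology_generated_by \<B>) S"
  then have "generate_topology_on \<B> S" by (rule openin_topology_generated_by)
  then show "openin ?T S"
  proof (rule generate_topology_on_coarsest[rotated 2])
    fix A assume A: "A \<in> \<B>"
    have "openin ?T (\<Union>\<B> \<inter> A)"
      unfolding openin_subbase
      using A by (intro arbitrary_union_of_inc relative_to_inc finite_intersection_of_inc)
    then show "openin ?T A"
      using A by (simp add: Int_absorb1 Sup_upper)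
  qed simp
qed

text \<open>
  By Alexander's subbase theorem only covers by sets \<open>U\<^sup>-\<close> and \<open>U\<^sup>+\<close> matter. Let \<open>C\<close> be
  the complement of the union of all \<open>U\<close> with \<open>U\<^sup>-\<close> in the cover. It lies in no such \<open>U\<^sup>-\<close>, so,
  unless it is empty, it lies in some \<open>V\<^sup>+\<close> of the cover. Finitely many of the \<open>U\<close> cover the compact complement of \<open>V\<close>, and a closed
  set that is not inside \<open>V\<close> meets one of them.
\<close>

lemma compact_space_hyperspace:
  assumes Y: "compact_space Y"
  shows "compact_space (hyperspace Y)"
  unfolding hyperspace_def
proof (rule Alexander_subbase[OF topology_generated_by_eq_subbase], fold hyperspace_def)
  fix \<C>
  assume sub: "\<C> \<subseteq> vietoris_minus Y ` {U. openin Y U} \<union> vietoris_plus Y ` {U. openin Y U}"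
    and cov: "\<Union>\<C> = topspace (hyperspace Y)"
  define \<U> where "\<U> = {U. openin Y U \<and> vietoris_minus Y U \<in> \<C>}"
  define C where "C = topspace Y - \<Union>\<U>"
  have top: "topspace (hyperspace Y) = closed_subsets Y" by (rule topspace_hyperspace)
  have opU: "\<And>U. U \<in> \<U> \<Longrightarrow> openin Y U" by (auto simp: \<U>_def)
  have cl: "closedin Y C"
    unfolding C_def by (intro closedin_diff) (auto intro: opU)
  \<comment> \<open>\<open>\<D>\<close> takes care of the closed sets inside \<open>V\<close>: it is a single \<open>V\<^sup>+\<close>, or empty together with \<open>V\<close>.\<close>
  have main: "\<exists>\<C>'. finite \<C>' \<and> \<C>' \<subseteq> \<C> \<and> \<Union>\<C>' = topspace (hyperspace Y)"
    if V: "openin Y V" "C \<subseteq> V" and \<D>: "\<D> \<subseteq> \<C>" "finite \<D>"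
      and D: "\<And>K. K \<in> closed_subsets Y \<Longrightarrow> K \<subseteq> V \<Longrightarrow> K \<in> \<Union>\<D>" for V \<D>
  proof -
    have "compactin Y (topspace Y - V)"
      using Y V by (intro closedin_compact_space) auto
    moreover have "topspace Y - V \<subseteq> \<Union>\<U>"
      using V by (auto simp: C_def)
    ultimately obtain \<F> where \<F>: "finite \<F>" "\<F> \<subseteq> \<U>" "topspace Y - V \<subseteq> \<Union>\<F>"
      using opU compactin_finite_subcover[of Y "topspace Y - V" \<U> "\<lambda>U. U"] by auto
    let ?C = "\<D> \<union> vietoris_minus Y ` \<F>"
    have "?C \<subseteq> \<C>" using \<F> \<D> by (auto simp: \<U>_def)
    moreover have "K \<in> \<Union>?C" if K: "K \<in> closed_subsets Y" for K
    proof (cases "K \<subseteq> V")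
      case True
      then show ?thesis using D K by auto
    next
      case False
      then obtain x where "x \<in> K" "x \<in> topspace Y - V"
        using K closedin_subset by (fastforce simp: closed_subsets_def)
      moreover obtain U where "U \<in> \<F>" "x \<in> U" using \<F> calculation by blast
      ultimately have "K \<in> vietoris_minus Y U" using K by (auto simp: vietoris_minus_def)
      then show ?thesis using \<open>U \<in> \<F>\<close> by blast
    qed
    ultimately have "\<Union>?C = topspace (hyperspace Y)"
      using cov top by blast
    then show ?thesis using \<open>?C \<subseteq> \<C>\<close> \<F> \<D> by (intro exI[of _ ?C]) auto
  qed
  show "\<exists>\<C>'. finite \<C>' \<and> \<C>' \<subseteq> \<C> \<and> \<Union>\<C>' = topspace (hyperspace Y)"
  proof (cases "C = {}")
    case True
    then show ?thesis
      by (intro main[of "{}" "{}"]) (auto simp: closed_subsets_def)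
  next
    case False
    then have C: "C \<in> closed_subsets Y" using cl by (simp add: closed_subsets_def)
    then obtain A where A: "A \<in> \<C>" "C \<in> A" using cov top by blast
    have "C \<notin> vietoris_minus Y U" if "vietoris_minus Y U \<in> \<C>" "openin Y U" for U
      using that by (auto simp: vietoris_minus_def C_def \<U>_def)
    then obtain V where V: "openin Y V" "A = vietoris_plus Y V"
      using sub A by auto
    show ?thesis
      using A V by (intro main[of V "{A}"]) (auto simp: vietoris_plus_def)
  qed
qed

text \<open>
  If \<open>x \<in> K\<close> and \<open>x \<notin> L\<close>, disjoint open \<open>U\<close> around \<open>x\<close> and \<open>V\<close> around \<open>L\<close> give the disjoint
  neighbourhoods \<open>U\<^sup>-\<close> of \<open>K\<close> and \<open>V\<^sup>+\<close> of \<open>L\<close>.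
\<close>

lemma Hausdorff_space_hyperspace:
  assumes Y: "regular_space Y"
  shows "Hausdorff_space (hyperspace Y)"
proof -
  have sep: "\<exists>U V. openin (hyperspace Y) U \<and> openin (hyperspace Y) V \<and> K \<in> U \<and> L \<in> V \<and> disjnt U V"
    if KL: "K \<in> closed_subsets Y" "L \<in> closed_subsets Y" "\<not> K \<subseteq> L" for K L
  proof -
    obtain x where x: "x \<in> K" "x \<notin> L" using KL by blast
    then have "x \<in> topspace Y - L" using KL closedin_subset by (fastforce simp: closed_subsets_def)
    moreover have "closedin Y L" using KL by (simp add: closed_subsets_def)
    ultimately obtain U V where "openin Y U" "openin Y V" "x \<in> U" "L \<subseteq> V" "disjnt U V"
      using Y[unfolded regular_space_def] by meson
    then have "disjnt (vietoris_minus Y U) (vietoris_plus Y V)"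
      unfolding vietoris_minus_def vietoris_plus_def disjnt_def by blast
    moreover have "K \<in> vietoris_minus Y U" "L \<in> vietoris_plus Y V"
      using KL x \<open>x \<in> U\<close> \<open>L \<subseteq> V\<close> by (auto simp: vietoris_minus_def vietoris_plus_def)
    ultimately show ?thesis
      using openin_hyperspace_minus[OF \<open>openin Y U\<close>] openin_hyperspace_plus[OF \<open>openin Y V\<close>] by blast
  qed
  show ?thesis
    unfolding Hausdorff_space_def topspace_hyperspace
  proof (intro allI impI)
    fix K L assume KL: "K \<in> closed_subsets Y \<and> L \<in> closed_subsets Y \<and> K \<noteq> L"
    then consider "\<not> K \<subseteq> L" | "\<not> L \<subseteq> K" by blast
    then show "\<exists>U V. openin (hyperspace Y) U \<and> openin (hyperspace Y) V \<and> K \<in> U \<and> L \<in> V \<and> disjnt U V"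
    proof cases
      case 1 then show ?thesis using sep KL by blast
    next
      case 2 then show ?thesis using sep[of L K] KL disjnt_sym by blast
    qed
  qed
qed

lemma continuous_map_into_hyperspaceI:
  assumes map: "\<And>x. x \<in> topspace T \<Longrightarrow> F x \<in> closed_subsets Y"
    and minus: "\<And>U x. openin Y U \<Longrightarrow> x \<in> topspace T \<Longrightarrow> F x \<inter> U \<noteq> {} \<Longrightarrow>
      \<exists>N. openin T N \<and> x \<in> N \<and> (\<forall>y\<in>N. F y \<inter> U \<noteq> {})"
    and plus: "\<And>U x. openin Y U \<Longrightarrow> x \<in> topspace T \<Longrightarrow> F x \<subseteq> U \<Longrightarrow>
      \<exists>N. openin T N \<and> x \<in> N \<and> (\<forall>y\<in>N. F y \<subseteq> U)"
  shows "continuous_map T (hyperspace Y) F"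
  unfolding hyperspace_def
proof (rule continuous_on_generated_topo)
  fix \<A> assume "\<A> \<in> vietoris_minus Y ` {U. openin Y U} \<union> vietoris_plus Y ` {U. openin Y U}"
  then consider U where "openin Y U" "\<A> = vietoris_minus Y U"
    | U where "openin Y U" "\<A> = vietoris_plus Y U" by auto
  then have "\<exists>N. openin T N \<and> x \<in> N \<and> N \<subseteq> F -` \<A> \<inter> topspace T"
    if x: "x \<in> F -` \<A> \<inter> topspace T" for x
  proof cases
    case 1
    then obtain N where "openin T N" "x \<in> N" "\<forall>y\<in>N. F y \<inter> U \<noteq> {}"
      using x minus[of U x] by (auto simp: vietoris_minus_def)
    then show ?thesis
      using 1 map by (intro exI[of _ N]) (auto simp: vietoris_minus_def dest: subsetD[OF openin_subset])
  next
    case 2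
    then obtain N where "openin T N" "x \<in> N" "\<forall>y\<in>N. F y \<subseteq> U"
      using x plus[of U x] by (auto simp: vietoris_plus_def)
    then show ?thesis
      using 2 map by (intro exI[of _ N]) (auto simp: vietoris_plus_def dest: subsetD[OF openin_subset])
  qed
  then show "openin T (F -` \<A> \<inter> topspace T)"
    by (subst openin_subopen) blast
next
  show "F ` topspace T \<subseteq> \<Union>(vietoris_minus Y ` {U. openin Y U} \<union> vietoris_plus Y ` {U. openin Y U})"
    using map topspace_hyperspace[of Y] unfolding hyperspace_def topology_generated_by_topspace by auto
qed

section \<open>The Riesz representation theorem on a compact Hausdorff space\<close>

lemma continuous_map_compact_space_bounded:
  fixes f :: "'a \<Rightarrow> 'b :: real_normed_vector"
  assumes X: "compact_space X" and f: "continuous_map X euclidean f"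
  shows "\<exists>B>0. \<forall>x\<in>topspace X. norm (f x) \<le> B"
proof -
  have "compactin euclidean (f ` topspace X)"
    using X f by (intro image_compactin[of X]) (auto simp: compact_space_def)
  then have "bounded (f ` topspace X)" by (simp add: compact_imp_bounded)
  then show ?thesis by (auto simp: bounded_pos)
qed

lemma integrable_continuous_map_compact_space:
  fixes f :: "'a \<Rightarrow> 'b :: {banach, second_countable_topology}"
  assumes X: "compact_space X" and M: "finite_measure M" "sets M = sets (sigma (topspace X) {U. openin X U})"
    and f: "continuous_map X euclidean f"
  shows "integrable M f"
proof -
  have sp: "space M = topspace X"
    using sets_eq_imp_space_eq[OF M(2)] by (simp add: space_measure_of_conv)
  have sets: "sets M = sigma_sets (topspace X) {U. openin X U}"
    using M(2) by (subst (asm) sets_measure_of) (auto dest: openin_subset)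
  have meas: "f \<in> borel_measurable M"
  proof (rule borel_measurableI)
    fix S :: "'b set" assume "open S"
    then have "openin X {x \<in> topspace X. f x \<in> S}"
      using f by (intro openin_continuous_map_preimage) auto
    moreover have "f -` S \<inter> space M = {x \<in> topspace X. f x \<in> S}" by (auto simp: sp)
    ultimately show "f -` S \<inter> space M \<in> sets M" by (auto simp: sets)
  qed
  obtain B where "\<And>x. x \<in> topspace X \<Longrightarrow> norm (f x) \<le> B"
    using continuous_map_compact_space_bounded[OF X f] by blast
  then show ?thesis
    using meas sp by (intro finite_measure.integrable_const_bound[OF M(1), of _ B]) auto
qed

text \<open>
  The functional acts on all real functions on the type, but only its values on continuous ones are
  constrained; by monotonicity these depend only on the restriction of the function to the space.
\<close>

locale normalized_positive_functional =
  fixes X :: "'a topology" and I :: "('a \<Rightarrow> real) \<Rightarrow> real"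
  assumes compact: "compact_space X" and Hausdorff: "Hausdorff_space X"
    and add: "\<And>f g. continuous_map X euclideanreal f \<Longrightarrow> continuous_map X euclideanreal g \<Longrightarrow>
      I (\<lambda>x. f x + g x) = I f + I g"
    and scale: "\<And>c f. continuous_map X euclideanreal f \<Longrightarrow> I (\<lambda>x. c * f x) = c * I f"
    and nonneg: "\<And>f. continuous_map X euclideanreal f \<Longrightarrow> (\<And>x. x \<in> topspace X \<Longrightarrow> 0 \<le> f x) \<Longrightarrow> 0 \<le> I f"
    and one: "I (\<lambda>_. 1) = 1"
begin

lemma normal: "normal_space X"
  using compact Hausdorff compact_Hausdorff_or_regular_imp_normal_space by blast

lemma mono:
  assumes f: "continuous_map X euclideanreal f" and g: "continuous_map X euclideanreal g"
    and le: "\<And>x. x \<in> topspace X \<Longrightarrow> f x \<le> g x"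
  shows "I f \<le> I g"
proof -
  have "0 \<le> I (\<lambda>x. g x + (-1) * f x)"
    using f g le by (intro nonneg continuous_intros) auto
  also have "\<dots> = I g + I (\<lambda>x. (-1) * f x)"
    using f g by (intro add continuous_intros) auto
  also have "I (\<lambda>x. (-1) * f x) = (-1) * I f"
    using f by (rule scale)
  finally show ?thesis by simp
qed

lemma cong:
  assumes "continuous_map X euclideanreal f" "continuous_map X euclideanreal g"
    and "\<And>x. x \<in> topspace X \<Longrightarrow> f x = g x"
  shows "I f = I g"
  using assms by (intro antisym mono) auto

lemma const: "I (\<lambda>_. c) = c"
  using scale[of "\<lambda>_. 1" c] one by simp

lemma sum:
  assumes "finite A" and "\<And>k. k \<in> A \<Longrightarrow> continuous_map X euclideanreal (f k)"
  shows "I (\<lambda>x. \<Sum>k\<in>A. f k x) = (\<Sum>k\<in>A. I (f k))"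
  using assms
proof (induction A rule: finite_induct)
  case (insert a A)
  then show ?case
    by (simp add: add continuous_map_sum)
qed (use const[of 0] in simp)

text \<open>
  \<open>0 \<le> f \<le> 1\<^sub>U\<close>. The closed support of \<open>f\<close> may reach beyond \<open>U\<close>; subtracting a small constant from
  \<open>f\<close> (\<open>below_cutoff\<close>) replaces the usual requirement that it be contained in \<open>U\<close>.
\<close>

definition below :: "'a set \<Rightarrow> ('a \<Rightarrow> real) \<Rightarrow> bool" where
  "below U f \<longleftrightarrow> continuous_map X euclideanreal f \<and>
     (\<forall>x\<in>topspace X. 0 \<le> f x \<and> f x \<le> 1 \<and> (x \<notin> U \<longrightarrow> f x = 0))"

definition open_mass :: "'a set \<Rightarrow> ennreal" where
  "open_mass U = (SUP f\<in>{f. below U f}. ennreal (I f))"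

definition outer :: "'a set \<Rightarrow> ennreal" where
  "outer A = (INF U\<in>{U. openin X U \<and> A \<subseteq> U}. open_mass U)"

lemma belowD:
  assumes "below U f"
  shows "continuous_map X euclideanreal f" "0 \<le> I f" "I f \<le> 1"
  using assms nonneg[of f] mono[of f "\<lambda>_. 1"] one by (auto simp: below_def)

lemma open_mass_upper: "below U f \<Longrightarrow> ennreal (I f) \<le> open_mass U"
  unfolding open_mass_def by (intro SUP_upper) auto

lemma open_mass_mono: "U \<subseteq> V \<Longrightarrow> open_mass U \<le> open_mass V"
  unfolding open_mass_def below_def by (intro SUP_subset_mono) blast+

lemma open_mass_le_1: "open_mass U \<le> 1"
  unfolding open_mass_def by (intro SUP_least) (auto dest: belowD)

lemma open_mass_empty: "open_mass {} = 0"
proof -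
  have "ennreal (I f) \<le> 0" if "below {} f" for f
    using cong[of f "\<lambda>_. 0"] const[of 0] that by (auto simp: below_def)
  then show ?thesis unfolding open_mass_def by (intro antisym SUP_least) auto
qed

lemma open_mass_topspace: "open_mass (topspace X) = 1"
  using open_mass_upper[of "topspace X" "\<lambda>_. 1"] open_mass_le_1[of "topspace X"] one
  by (auto simp: below_def intro: antisym)

lemma outer_open: "openin X U \<Longrightarrow> outer U = open_mass U"
  unfolding outer_def by (intro antisym INF_lower INF_greatest open_mass_mono) auto

text \<open>
  Cutting \<open>f\<close> off at height \<open>e\<close> costs at most \<open>e\<close> in the functional, and leaves a function that
  vanishes off the closed, hence compact, set where \<open>f\<close> is at least \<open>e\<close>. This is how compactness
  enters the estimates for the open mass.
\<close>

lemma below_cutoff: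
  assumes f: "below U f" and e: "0 < e" "\<And>x. x \<in> topspace X \<Longrightarrow> e \<le> f x \<Longrightarrow> x \<in> V"
  shows "below V (\<lambda>x. max 0 (f x - e))" "I f \<le> e + I (\<lambda>x. max 0 (f x - e))"
proof -
  have c: "continuous_map X euclideanreal f" using f by (rule belowD)
  then have c': "continuous_map X euclideanreal (\<lambda>x. max 0 (f x - e))"
    by (intro continuous_intros) auto
  then show "below V (\<lambda>x. max 0 (f x - e))"
    using f e by (force simp: below_def max_def)
  have "I f \<le> I (\<lambda>x. e + max 0 (f x - e))"
    using c c' by (intro mono continuous_intros) auto
  also have "\<dots> = I (\<lambda>x. e) + I (\<lambda>x. max 0 (f x - e))"
    using c' by (intro add) auto
  finally show "I f \<le> e + I (\<lambda>x. max 0 (f x - e))" by (simp add: const)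
qed

lemma closedin_superlevel:
  "continuous_map X euclideanreal f \<Longrightarrow> closedin X {x \<in> topspace X. e \<le> f x}"
  using closedin_continuous_map_preimage[of X euclideanreal f "{e..}"] by simp

lemma openin_superlevel:
  "continuous_map X euclideanreal f \<Longrightarrow> openin X {x \<in> topspace X. e < f x}"
  using openin_continuous_map_preimage[of X euclideanreal f "{e<..}"] by simp

text \<open>
  Let \<open>g\<close> be the cutoff of a function below \<open>U \<union> V\<close>, and let \<open>C\<close> be the compact subset of \<open>U \<union> V\<close>
  outside which \<open>g\<close> vanishes. A Urysohn function \<open>u\<close> that is \<open>1\<close> on \<open>C - V\<close> and \<open>0\<close> off \<open>U\<close> splits
  \<open>g\<close> into \<open>g u\<close> below \<open>U\<close> and \<open>g (1 - u)\<close> below \<open>V\<close>.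
\<close>

lemma open_mass_Un:
  assumes U: "openin X U" and V: "openin X V"
  shows "open_mass (U \<union> V) \<le> open_mass U + open_mass V"
  unfolding open_mass_def[of "U \<union> V"]
proof (rule SUP_least, rule ennreal_le_epsilon)
  fix f and e :: real assume "f \<in> {f. below (U \<union> V) f}" and e: "0 < e"
  then have f: "below (U \<union> V) f" by simp
  define g where "g = (\<lambda>x. max 0 (f x - e))"
  define C where "C = {x \<in> topspace X. e \<le> f x}"
  have fc: "continuous_map X euclideanreal f" using f by (rule belowD)
  have C_sub: "C \<subseteq> U \<union> V" using f e by (force simp: C_def below_def)
  have "closedin X C" unfolding C_def using fc by (rule closedin_superlevel)
  then have "closedin X (C - V)" "closedin X (topspace X - U)" "disjnt (topspace X - U) (C - V)"
    using U V C_sub by (auto simp: disjnt_def closedin_diff)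
  then obtain u where u: "continuous_map X (top_of_set {0..1::real}) u"
    "u ` (topspace X - U) \<subseteq> {0}" "u ` (C - V) \<subseteq> {1}"
    using Urysohn_lemma[OF normal, of "topspace X - U" "C - V" 0 1] by (metis zero_le_one)
  have uc: "continuous_map X euclideanreal u" and u01: "\<And>x. x \<in> topspace X \<Longrightarrow> 0 \<le> u x \<and> u x \<le> 1"
    using u(1) by (auto simp: continuous_map_in_subtopology)
  have g: "below (U \<union> V) g" "I f \<le> e + I g"
    using below_cutoff[OF f e, of "U \<union> V"] C_sub by (auto simp: g_def C_def)
  have gc: "continuous_map X euclideanreal g" using g(1) by (rule belowD)
  have gu: "below U (\<lambda>x. g x * u x)"
    using g(1) uc u01 u(2) by (auto simp: below_def image_subset_iff intro!: continuous_intros mult_le_one)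
  have gv: "below V (\<lambda>x. g x * (1 - u x))"
    unfolding below_def
  proof (intro conjI ballI impI)
    fix x assume x: "x \<in> topspace X"
    show "0 \<le> g x * (1 - u x)" "g x * (1 - u x) \<le> 1"
      using g(1) u01[OF x] x by (auto simp: below_def intro!: mult_le_one)
    assume "x \<notin> V"
    then show "g x * (1 - u x) = 0"
      using u(3) x by (cases "x \<in> C") (auto simp: C_def g_def image_subset_iff)
  qed (use gc uc in \<open>intro continuous_intros\<close>)
  have "I g = I (\<lambda>x. g x * u x + g x * (1 - u x))"
    by (simp add: algebra_simps)
  also have "\<dots> = I (\<lambda>x. g x * u x) + I (\<lambda>x. g x * (1 - u x))"
    using gu gv by (intro add belowD)
  finally have "I f \<le> I (\<lambda>x. g x * u x) + I (\<lambda>x. g x * (1 - u x)) + e"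
    using g(2) by simp
  then have "ennreal (I f) \<le> ennreal (I (\<lambda>x. g x * u x)) + ennreal (I (\<lambda>x. g x * (1 - u x))) + ennreal e"
    using e belowD(2)[OF gu] belowD(2)[OF gv]
    by (simp flip: ennreal_plus add: ennreal_leI)
  also have "\<dots> \<le> open_mass U + open_mass V + ennreal e"
    using gu gv by (intro add_mono open_mass_upper) auto
  finally show "ennreal (I f) \<le> open_mass U + open_mass V + ennreal e" .
qed

lemma open_mass_UN_finite:
  assumes "\<And>i. openin X (U i)"
  shows "open_mass (\<Union>i<n::nat. U i) \<le> (\<Sum>i<n. open_mass (U i))"
proof (induction n)
  case 0
  show ?case by (simp add: open_mass_empty)
next
  case (Suc n)
  have "open_mass (\<Union>i<Suc n. U i) \<le> open_mass (\<Union>i<n. U i) + open_mass (U n)"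
    using assms open_mass_Un[of "\<Union>i<n. U i" "U n"] by (auto simp: lessThan_Suc Un_commute)
  then show ?case using Suc by (auto intro: order_trans add_right_mono)
qed

lemma open_mass_UN:
  fixes U :: "nat \<Rightarrow> 'a set"
  assumes U: "\<And>i. openin X (U i)"
  shows "open_mass (\<Union>i. U i) \<le> (\<Sum>i. open_mass (U i))"
  unfolding open_mass_def[of "\<Union>i. U i"]
proof (rule SUP_least, rule ennreal_le_epsilon)
  fix f and e :: real assume "f \<in> {f. below (\<Union>i. U i) f}" and e: "0 < e"
  then have f: "below (\<Union>i. U i) f" by simp
  define C where "C = {x \<in> topspace X. e \<le> f x}"
  have "C \<subseteq> (\<Union>i. U i)" using f e by (force simp: C_def below_def)
  moreover have "compactin X C"
    unfolding C_def using compact belowD(1)[OF f] by (intro closedin_compact_space closedin_superlevel)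
  ultimately obtain J where J: "finite J" "C \<subseteq> (\<Union>i\<in>J. U i)"
    using compactin_finite_subcover[of X C UNIV U] U by auto
  then obtain n where n: "J \<subseteq> {..<n}" by (metis finite_nat_iff_bounded)
  then have C: "C \<subseteq> (\<Union>i<n. U i)" using J by blast
  let ?g = "\<lambda>x. max 0 (f x - e)"
  have g: "below (\<Union>i<n. U i) ?g" "I f \<le> e + I ?g"
    using below_cutoff[OF f e, of "\<Union>i<n. U i"] C by (auto simp: C_def)
  then have "ennreal (I f) \<le> ennreal (I ?g) + ennreal e"
    using e belowD(2)[OF g(1)] by (simp flip: ennreal_plus add: ennreal_leI add.commute)
  also have "ennreal (I ?g) \<le> open_mass (\<Union>i<n. U i)"
    using g by (intro open_mass_upper)
  also have "\<dots> \<le> (\<Sum>i<n. open_mass (U i))"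
    using U by (rule open_mass_UN_finite)
  also have "\<dots> \<le> (\<Sum>i. open_mass (U i))"
    by (intro sum_le_suminf summableI) auto
  finally show "ennreal (I f) \<le> (\<Sum>i. open_mass (U i)) + ennreal e"
    by (simp add: add_right_mono)
qed

lemma outer_mono: "A \<subseteq> B \<Longrightarrow> outer A \<le> outer B"
  unfolding outer_def by (intro INF_superset_mono) auto

lemma outer_approx:
  assumes "A \<subseteq> topspace X" and e: "0 < e"
  obtains U where "openin X U" "A \<subseteq> U" "open_mass U \<le> outer A + ennreal e"
proof -
  have "outer A \<le> outer (topspace X)" using assms by (intro outer_mono)
  also have "\<dots> = 1" by (simp add: outer_open open_mass_topspace)
  finally have "outer A < \<top>" by (auto simp: order_le_less_trans)
  then have "outer A < outer A + ennreal e"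
    using e by (simp add: ennreal_add_left_cancel_less)
  then obtain U where "openin X U" "A \<subseteq> U" "open_mass U < outer A + ennreal e"
    unfolding outer_def[of A] INF_less_iff by auto
  then show ?thesis using that by (meson less_imp_le)
qed

lemma outer_UN:
  fixes A :: "nat \<Rightarrow> 'a set"
  assumes A: "\<And>i. A i \<subseteq> topspace X"
  shows "outer (\<Union>i. A i) \<le> (\<Sum>i. outer (A i))"
proof (rule ennreal_le_epsilon)
  fix e :: real assume e: "0 < e"
  have "\<exists>U. openin X U \<and> A i \<subseteq> U \<and> open_mass U \<le> outer (A i) + ennreal (e * (1/2)^Suc i)" for i
    using outer_approx[OF A[of i], of "e * (1/2)^Suc i"] e by (metis mult_pos_pos half_gt_zero zero_less_one zero_less_power)
  then obtain U where U: "\<And>i. openin X (U i)" "\<And>i. A i \<subseteq> U i"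
    "\<And>i. open_mass (U i) \<le> outer (A i) + ennreal (e * (1/2)^Suc i)" by metis
  have "outer (\<Union>i. A i) \<le> outer (\<Union>i. U i)"
    using U by (intro outer_mono) auto
  also have "\<dots> = open_mass (\<Union>i. U i)"
    using U by (intro outer_open) auto
  also have "\<dots> \<le> (\<Sum>i. open_mass (U i))"
    using U by (intro open_mass_UN)
  also have "\<dots> \<le> (\<Sum>i. outer (A i) + ennreal (e * (1/2)^Suc i))"
    using U by (intro suminf_le summableI) auto
  also have "\<dots> = (\<Sum>i. outer (A i)) + (\<Sum>i. ennreal (e * (1/2)^Suc i))"
    by (intro suminf_add[symmetric] summableI)
  also have "(\<Sum>i. ennreal (e * (1/2)^Suc i)) = ennreal e"
    using e sums_mult[OF power_half_series, of e] by (intro suminf_ennreal_eq) auto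
  finally show "outer (\<Union>i. A i) \<le> (\<Sum>i. outer (A i)) + ennreal e" .
qed

lemma outer_measure_space_outer: "outer_measure_space (Pow (topspace X)) outer"
  unfolding outer_measure_space_def
proof (intro conjI)
  show "positive (Pow (topspace X)) outer"
    by (simp add: positive_def outer_open open_mass_empty)
  show "increasing (Pow (topspace X)) outer"
    by (auto simp: increasing_def intro: outer_mono)
  show "countably_subadditive (Pow (topspace X)) outer"
    unfolding countably_subadditive_def by (auto intro!: outer_UN)
qed

lemma outer_Un:
  assumes "A \<subseteq> topspace X" "B \<subseteq> topspace X" "A \<inter> B = {}"
  shows "outer (A \<union> B) \<le> outer A + outer B"
proof -
  interpret sigma_algebra "topspace X" "Pow (topspace X)" by (rule sigma_algebra_Pow)
  show ?thesis
    using outer_measure_space_outer countably_subadditive_subadditive[of outer] assms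
    by (auto simp: outer_measure_space_def dest: subadditiveD)
qed

text \<open>
  For \<open>f\<close> below \<open>U \<inter> V\<close>, the cutoff \<open>h\<close> of \<open>f\<close> lives on a closed set \<open>C \<subseteq> U \<inter> V\<close>. Hence \<open>h + g\<close>
  is still below \<open>V\<close> for every \<open>g\<close> below the open set \<open>V - C\<close>, which contains \<open>V - U\<close>.
\<close>

lemma open_mass_split:
  assumes U: "openin X U" and V: "openin X V"
  shows "outer (U \<inter> V) + outer (V - U) \<le> open_mass V"
proof -
  have UV: "openin X (U \<inter> V)" using U V by (rule openin_Int)
  have *: "ennreal (I f) + outer (V - U) \<le> open_mass V + ennreal e" if f: "below (U \<inter> V) f" and e: "0 < e" for f e
  proof -
    define C where "C = {x \<in> topspace X. e \<le> f x}"
    let ?h = "\<lambda>x. max 0 (f x - e)"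
    have cC: "closedin X C" unfolding C_def using f by (intro closedin_superlevel belowD)
    have C: "C \<subseteq> U \<inter> V" using f e by (force simp: C_def below_def)
    have h: "below (U \<inter> V) ?h" "I f \<le> e + I ?h"
      using below_cutoff[OF f e, of "U \<inter> V"] C by (auto simp: C_def)
    have "open_mass (V - C) + (ennreal (I ?h)) \<le> open_mass V"
      unfolding open_mass_def[of "V - C"]
    proof (subst ennreal_SUP_add_left[symmetric])
      have "below (V - C) (\<lambda>_. 0)" by (auto simp: below_def)
      then show "{f. below (V - C) f} \<noteq> {}" by blast
      show "(SUP f\<in>{f. below (V - C) f}. ennreal (I f) + ennreal (I ?h)) \<le> open_mass V"
      proof (rule SUP_least)
        fix g assume "g \<in> {f. below (V - C) f}"
        then have g: "below (V - C) g" by simp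
        have "below V (\<lambda>x. g x + ?h x)"
          unfolding below_def
        proof (intro conjI ballI)
          show "continuous_map X euclideanreal (\<lambda>x. g x + ?h x)"
            using belowD(1)[OF g] belowD(1)[OF h(1)] by (rule continuous_map_add)
          fix x assume x: "x \<in> topspace X"
          have "g x = 0 \<or> ?h x = 0" "x \<notin> V \<longrightarrow> g x = 0 \<and> ?h x = 0"
            using g h(1) x by (auto simp: below_def C_def)
          then show "0 \<le> g x + ?h x" "g x + ?h x \<le> 1" "x \<notin> V \<longrightarrow> g x + ?h x = 0"
            using g h(1) x unfolding below_def by force+
        qed
        then have "ennreal (I (\<lambda>x. g x + ?h x)) \<le> open_mass V" by (rule open_mass_upper)
        also have "I (\<lambda>x. g x + ?h x) = I g + I ?h"
          using g h(1) by (intro add belowD)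
        finally show "ennreal (I g) + ennreal (I ?h) \<le> open_mass V"
          using belowD(2)[OF g] belowD(2)[OF h(1)] by simp
      qed
    qed
    moreover have "outer (V - U) \<le> open_mass (V - C)"
      using C outer_mono[of "V - U" "V - C"] outer_open[OF openin_diff[OF V cC]] by auto
    moreover have "ennreal (I f) \<le> ennreal (I ?h) + ennreal e"
      using h e belowD(2)[OF h(1)] by (simp flip: ennreal_plus add: ennreal_leI add.commute)
    ultimately have "ennreal (I f) + outer (V - U) \<le> (ennreal (I ?h) + ennreal e) + open_mass (V - C)"
      by (intro add_mono)
    also have "\<dots> = (open_mass (V - C) + ennreal (I ?h)) + ennreal e" by (simp add: ac_simps)
    also have "\<dots> \<le> open_mass V + ennreal e"
      using \<open>open_mass (V - C) + _ \<le> _\<close> by (intro add_right_mono)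
    finally show ?thesis .
  qed
  have "outer (U \<inter> V) + outer (V - U) = (SUP f\<in>{f. below (U \<inter> V) f}. ennreal (I f) + outer (V - U))"
  proof -
    have "below (U \<inter> V) (\<lambda>_. 0)" by (auto simp: below_def)
    then have "{f. below (U \<inter> V) f} \<noteq> {}" by blast
    then show ?thesis
      using outer_open[OF UV] unfolding open_mass_def by (simp add: ennreal_SUP_add_left)
  qed
  also have "\<dots> \<le> open_mass V"
  proof (rule SUP_least, rule ennreal_le_epsilon)
    fix f and e :: real assume "f \<in> {f. below (U \<inter> V) f}" "0 < e"
    then show "ennreal (I f) + outer (V - U) \<le> open_mass V + ennreal e"
      by (intro *) simp
  qed
  finally show ?thesis .
qed

text \<open>
  Since the outer measure of any set is an infimum over open sets, Caratheodory's condition for \<open>U\<close>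
  has to be tested on open sets only.
\<close>

lemma open_in_lambda_system:
  assumes U: "openin X U"
  shows "U \<in> lambda_system (topspace X) (Pow (topspace X)) outer"
proof -
  have Ut: "U \<subseteq> topspace X" using U by (rule openin_subset)
  have "outer (U \<inter> A) + outer ((topspace X - U) \<inter> A) = outer A" if A: "A \<subseteq> topspace X" for A
  proof (rule antisym)
    have "outer (U \<inter> A) + outer ((topspace X - U) \<inter> A) \<le> open_mass V" if V: "openin X V" "A \<subseteq> V" for V
    proof -
      have "outer (U \<inter> A) + outer ((topspace X - U) \<inter> A) \<le> outer (U \<inter> V) + outer (V - U)"
        using V by (intro add_mono outer_mono) auto
      also have "\<dots> \<le> open_mass V" using U V by (intro open_mass_split)
      finally show ?thesis .
    qed
    then show "outer (U \<inter> A) + outer ((topspace X - U) \<inter> A) \<le> outer A"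
      unfolding outer_def[of A] by (intro INF_greatest) auto
    have "outer A = outer ((U \<inter> A) \<union> ((topspace X - U) \<inter> A))"
      using A by (intro arg_cong[of _ _ outer]) auto
    also have "\<dots> \<le> outer (U \<inter> A) + outer ((topspace X - U) \<inter> A)"
      using A by (intro outer_Un) auto
    finally show "outer A \<le> outer (U \<inter> A) + outer ((topspace X - U) \<inter> A)" .
  qed
  then show ?thesis using Ut by (auto simp: lambda_system_def)
qed

definition riesz_measure :: "'a measure" where
  "riesz_measure = measure_of (topspace X) {U. openin X U} outer"

lemma open_subset_Pow: "{U. openin X U} \<subseteq> Pow (topspace X)"
  by (auto dest: openin_subset)

lemma sets_riesz_measure: "sets riesz_measure = sigma_sets (topspace X) {U. openin X U}"
  unfolding riesz_measure_def using open_subset_Pow by (rule sets_measure_of)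

lemma space_riesz_measure: "space riesz_measure = topspace X"
  unfolding riesz_measure_def using open_subset_Pow by (rule space_measure_of)

lemma emeasure_riesz_measure:
  assumes "A \<in> sets riesz_measure"
  shows "emeasure riesz_measure A = outer A"
proof -
  let ?L = "lambda_system (topspace X) (Pow (topspace X)) outer"
  interpret sigma_algebra "topspace X" "Pow (topspace X)" by (rule sigma_algebra_Pow)
  have L: "measure_space (topspace X) ?L outer"
    using outer_measure_space_outer by (rule caratheodory_lemma)
  then have "sigma_sets (topspace X) {U. openin X U} \<subseteq> ?L"
    using open_in_lambda_system
    by (intro sigma_algebra.sigma_sets_subset) (auto simp: measure_space_def)
  then have "measure_space (topspace X) (sigma_sets (topspace X) {U. openin X U}) outer"
    using L open_subset_Pow by (intro measure_down[OF L] sigma_algebra_sigma_sets)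
  then show ?thesis
    using assms open_subset_Pow
    by (intro emeasure_measure_of[OF riesz_measure_def])
      (auto simp: measure_space_def sets_riesz_measure[symmetric])
qed

lemma open_in_sets: "openin X U \<Longrightarrow> U \<in> sets riesz_measure"
  by (auto simp: sets_riesz_measure)

lemma prob_space_riesz_measure: "prob_space riesz_measure"
proof
  show "emeasure riesz_measure (space riesz_measure) = 1"
    by (simp add: space_riesz_measure emeasure_riesz_measure open_in_sets outer_open open_mass_topspace)
qed

text \<open>
  Outer regularity is the definition of the outer measure. Inner regularity follows by taking
  complements, as the total mass is finite and complements of open sets are compact.
\<close>

lemma riesz_measure_regular: "riesz_measure \<in> regular_borel_probs X"
proof -
  let ?M = riesz_measure
  interpret prob_space ?M by (rule prob_space_riesz_measure)
  have outer_reg: "emeasure ?M A = (INF U\<in>{U. openin X U \<and> A \<subseteq> U}. emeasure ?M U)" if "A \<in> sets ?M" for A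
  proof -
    have "emeasure ?M A = (INF U\<in>{U. openin X U \<and> A \<subseteq> U}. open_mass U)"
      using that by (simp only: emeasure_riesz_measure outer_def)
    also have "\<dots> = (INF U\<in>{U. openin X U \<and> A \<subseteq> U}. emeasure ?M U)"
      by (intro INF_cong refl) (simp add: emeasure_riesz_measure open_in_sets outer_open)
    finally show ?thesis .
  qed
  have comp: "C \<in> sets ?M" if "compactin X C" for C
  proof -
    have "openin X (topspace X - C)"
      using that Hausdorff compactin_imp_closedin by blast
    then have "space ?M - (topspace X - C) \<in> sets ?M" using open_in_sets by blast
    then show ?thesis
      using that by (simp add: space_riesz_measure double_diff compactin_subset_topspace)
  qed
  have inner_reg: "emeasure ?M A = (SUP C\<in>{C. compactin X C \<and> C \<subseteq> A}. emeasure ?M C)" (is "_ = ?S") if A: "A \<in> sets ?M" for A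
  proof (rule antisym)
    show "?S \<le> emeasure ?M A"
      using A by (intro SUP_least emeasure_mono) auto
    show "emeasure ?M A \<le> ?S"
    proof (rule ennreal_le_epsilon)
      fix e :: real assume e: "0 < e"
      have At: "A \<subseteq> topspace X" using A sets.sets_into_space[of A ?M] by (simp add: space_riesz_measure)
      obtain U where U: "openin X U" "topspace X - A \<subseteq> U" "open_mass U \<le> outer (topspace X - A) + ennreal e"
        using outer_approx[of "topspace X - A" e] e by auto
      have comp_A: "topspace X - A \<in> sets ?M"
        using A sets.compl_sets[of A ?M] by (simp add: space_riesz_measure)
      have "emeasure ?M U \<le> emeasure ?M (topspace X - A) + ennreal e"
        using U comp_A by (simp add: emeasure_riesz_measure open_in_sets outer_open)
      then have le: "prob U \<le> (1 - prob A) + e"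
        using e A prob_compl[of A]
        by (simp add: emeasure_eq_measure space_riesz_measure flip: ennreal_plus)
      have "compactin X (topspace X - U)"
        using U compact by (intro closedin_compact_space) auto
      moreover have "topspace X - U \<subseteq> A" using U At by blast
      ultimately have "emeasure ?M (topspace X - U) \<le> ?S" by (intro SUP_upper) auto
      moreover have "prob (topspace X - U) = 1 - prob U"
        using prob_compl[of U] open_in_sets[OF U(1)] by (simp add: space_riesz_measure)
      then have "prob A \<le> prob (topspace X - U) + e" using le by simp
      then have "emeasure ?M A \<le> emeasure ?M (topspace X - U) + ennreal e"
        using e by (simp add: emeasure_eq_measure flip: ennreal_plus)
      ultimately show "emeasure ?M A \<le> ?S + ennreal e"
        by (meson add_right_mono order_trans)
    qed
  qed
  have "sets ?M = sets (sigma (topspace X) {U. openin X U})"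
    using open_subset_Pow by (simp add: sets_riesz_measure sets_measure_of)
  then show ?thesis
    unfolding regular_borel_probs_def mem_Collect_eq
    using prob_space_axioms outer_reg inner_reg by blast
qed

lemma integrable_riesz:
  fixes f :: "'a \<Rightarrow> real"
  shows "continuous_map X euclideanreal f \<Longrightarrow> integrable riesz_measure f"
  by (rule integrable_continuous_map_compact_space[OF compact])
    (simp_all add: prob_space_riesz_measure prob_space.finite_measure sets_riesz_measure sets_measure_of open_subset_Pow)

text \<open>
  The function \<open>f\<close> is the sum of horizontal slices \<open>s\<^sub>k\<close> of height \<open>d\<close>, where \<open>s\<^sub>k / d\<close> lies
  between the indicators of \<open>{f > (k + 1) d}\<close> and \<open>{f > k d}\<close>. Therefore \<open>I\<close> of the slice \<open>k + 1\<close> is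
  at most \<open>d\<close> times the measure of \<open>{f > (k + 1) d}\<close>, which is at most the integral of the slice \<open>k\<close>;
  only the lowest slice is lost, and it contributes at most \<open>d\<close>.
\<close>

lemma functional_le_integral:
  assumes f: "continuous_map X euclideanreal f" and f01: "\<And>x. x \<in> topspace X \<Longrightarrow> 0 \<le> f x \<and> f x \<le> 1"
  shows "I f \<le> integral\<^sup>L riesz_measure f"
proof (rule field_le_epsilon)
  fix e :: real assume "0 < e"
  let ?M = riesz_measure
  interpret prob_space ?M by (rule prob_space_riesz_measure)
  obtain m where m: "inverse (real (Suc m)) < e" using \<open>0 < e\<close> reals_Archimedean by blast
  define d where "d = inverse (real (Suc m))"
  have d: "0 < d" "real (Suc m) * d = 1" "d < e" using m by (auto simp: d_def)
  define s where "s = (\<lambda>k::nat. \<lambda>x. min (max (f x - real k * d) 0) d)"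
  define U where "U = (\<lambda>k::nat. {x \<in> topspace X. real k * d < f x})"
  have sc: "continuous_map X euclideanreal (s k)" for k
    unfolding s_def using f by (intro continuous_intros) auto
  have U: "openin X (U k)" for k
    unfolding U_def using f by (rule openin_superlevel)
  have slices: "(\<Sum>k<n. s k x) = min (f x) (real n * d)" if "x \<in> topspace X" for n x
  proof (induction n)
    case 0
    then show ?case using f01[OF that] by simp
  next
    case (Suc n)
    then show ?case using d by (auto simp: s_def min_def max_def algebra_simps)
  qed
  have f_eq: "f x = (\<Sum>k<Suc m. s k x)" if "x \<in> topspace X" for x
    using slices[OF that, of "Suc m"] f01[OF that] d by simp
  have I_le: "I (s k) \<le> d * prob (U k)" for k
  proof -
    have "below (U k) (\<lambda>x. (1/d) * s k x)"
      unfolding below_def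
    proof (intro conjI ballI impI)
      show "continuous_map X euclideanreal (\<lambda>x. (1/d) * s k x)"
        using sc by (intro continuous_map_real_mult_left)
    qed (use d in \<open>auto simp: s_def U_def field_simps\<close>)
    then have "ennreal (I (\<lambda>x. (1/d) * s k x)) \<le> emeasure ?M (U k)"
      using U[of k] open_mass_upper by (simp add: emeasure_riesz_measure open_in_sets outer_open)
    then have "I (\<lambda>x. (1/d) * s k x) \<le> prob (U k)"
      by (simp add: emeasure_eq_measure)
    then have "(1/d) * I (s k) \<le> prob (U k)"
      by (simp only: scale[OF sc[of k]])
    then show ?thesis
      using d by (simp add: field_simps)
  qed
  have le_int: "d * prob (U (Suc k)) \<le> integral\<^sup>L ?M (s k)" for k
  proof -
    have "d * prob (U (Suc k)) = integral\<^sup>L ?M (\<lambda>x. d * indicator (U (Suc k)) x)"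
      using open_in_sets[OF U] by simp
    also have "\<dots> \<le> integral\<^sup>L ?M (s k)"
    proof (rule integral_mono)
      show "integrable ?M (\<lambda>x. d * indicator (U (Suc k)) x :: real)"
        using open_in_sets[OF U] by (auto intro!: integrable_real_indicator simp: emeasure_eq_measure)
      show "integrable ?M (s k)" using sc by (rule integrable_riesz)
      show "d * indicator (U (Suc k)) x \<le> s k x" for x
        using d by (auto simp: indicator_def U_def s_def algebra_simps)
    qed
    finally show ?thesis .
  qed
  have "I f = I (\<lambda>x. \<Sum>k<Suc m. s k x)"
    using f sc f_eq by (intro cong continuous_intros) auto
  also have "\<dots> = (\<Sum>k<Suc m. I (s k))"
    using sc by (intro sum) auto
  also have "\<dots> = I (s 0) + (\<Sum>k<m. I (s (Suc k)))"
    by (rule sum.lessThan_Suc_shift)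
  also have "\<dots> \<le> d + (\<Sum>k<m. integral\<^sup>L ?M (s k))"
  proof (intro add_mono sum_mono)
    show "I (s 0) \<le> d"
      using I_le[of 0] d mult_left_le[OF prob_le_1[of "U 0"], of d] by linarith
    show "I (s (Suc k)) \<le> integral\<^sup>L ?M (s k)" for k
      using I_le[of "Suc k"] le_int[of k] by simp
  qed
  also have "(\<Sum>k<m. integral\<^sup>L ?M (s k)) \<le> (\<Sum>k<Suc m. integral\<^sup>L ?M (s k))"
    using d by (auto intro!: integral_nonneg simp: s_def)
  also have "(\<Sum>k<Suc m. integral\<^sup>L ?M (s k)) = integral\<^sup>L ?M (\<lambda>x. \<Sum>k<Suc m. s k x)"
    using sc by (intro Bochner_Integration.integral_sum[symmetric] integrable_riesz)
  also have "\<dots> = integral\<^sup>L ?M f"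
    using f_eq by (intro Bochner_Integration.integral_cong) (auto simp: space_riesz_measure)
  finally show "I f \<le> integral\<^sup>L ?M f + e" using d by simp
qed

text \<open>
  The inequality \<open>functional_le_integral\<close> for \<open>f\<close> and for \<open>1 - f\<close> together gives equality, because
  both sides are normalised. Rescaling the values affinely reduces bounded functions to this case.
\<close>

theorem riesz_representation:
  assumes f: "continuous_map X euclideanreal f"
  shows "I f = integral\<^sup>L riesz_measure f"
proof -
  let ?M = riesz_measure
  interpret prob_space ?M by (rule prob_space_riesz_measure)
  have *: "I g = integral\<^sup>L ?M g"
    if g: "continuous_map X euclideanreal g" and g01: "\<And>x. x \<in> topspace X \<Longrightarrow> 0 \<le> g x \<and> g x \<le> 1" for g
  proof (rule antisym)
    show "I g \<le> integral\<^sup>L ?M g" using that by (rule functional_le_integral)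
    have "I (\<lambda>x. 1 + (-1) * g x) \<le> integral\<^sup>L ?M (\<lambda>x. 1 + (-1) * g x)"
      using g g01 by (intro functional_le_integral continuous_intros) auto
    also have "\<dots> = 1 - integral\<^sup>L ?M g"
      using integrable_riesz[OF g] by (simp add: prob_space)
    also have "I (\<lambda>x. 1 + (-1) * g x) = I (\<lambda>x. 1) + I (\<lambda>x. (-1) * g x)"
      using g by (intro add continuous_map_real_mult_left) auto
    also have "\<dots> = 1 - I g"
      by (simp only: one scale[OF g])
    finally show "integral\<^sup>L ?M g \<le> I g" by simp
  qed
  obtain b where b: "0 < b" "\<And>x. x \<in> topspace X \<Longrightarrow> \<bar>f x\<bar> \<le> b"
    using continuous_map_compact_space_bounded[OF compact f] by auto
  define g where "g = (\<lambda>x. 1/2 + (1/(2*b)) * f x)"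
  have g: "continuous_map X euclideanreal g"
    unfolding g_def using f by (intro continuous_intros continuous_map_real_mult_left) auto
  have "I g = integral\<^sup>L ?M g"
  proof (rule *[OF g])
    fix x assume "x \<in> topspace X"
    then have "- b \<le> f x" "f x \<le> b" using b(2)[of x] by auto
    then show "0 \<le> g x \<and> g x \<le> 1" using b(1) by (auto simp: g_def field_simps)
  qed
  moreover have "I g = 1/2 + (1/(2*b)) * I f"
    unfolding g_def using f by (subst add) (auto simp only: const scale continuous_map_real_mult_left continuous_map_const topspace_euclidean UNIV_I)
  moreover have "integral\<^sup>L ?M g = 1/2 + (1/(2*b)) * integral\<^sup>L ?M f"
    unfolding g_def using integrable_riesz[OF f] by (simp add: prob_space)
  ultimately show ?thesis using b by simp
qed

end

section \<open>States on the algebra of continuous functions\<close>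

text \<open>
  Positivity and supports are questions about real functions; this embeds them into $C(X)$ with
  the normalisation outside the space that membership in $C(X)$ demands.
\<close>

definition complexify :: "'a topology \<Rightarrow> ('a \<Rightarrow> real) \<Rightarrow> 'a \<Rightarrow> complex" where
  "complexify X g = (\<lambda>x\<in>topspace X. complex_of_real (g x))"

lemma continuous_map_of_real:
  "continuous_map X euclideanreal g \<Longrightarrow> continuous_map X euclidean (\<lambda>x. complex_of_real (g x))"
  by (simp add: continuous_map_atin tendsto_of_real)

lemma continuous_map_Re_Im:
  assumes "continuous_map X euclidean (f :: 'a \<Rightarrow> complex)"
  shows "continuous_map X euclideanreal (\<lambda>x. Re (f x))" "continuous_map X euclideanreal (\<lambda>x. Im (f x))"
  using assms by (simp_all add: continuous_map_atin tendsto_Re tendsto_Im)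

lemma continuous_map_complex_mult:
  fixes f g :: "'a \<Rightarrow> complex"
  assumes "continuous_map X euclidean f" "continuous_map X euclidean g"
  shows "continuous_map X euclidean (\<lambda>x. f x * g x)"
  using assms by (simp add: continuous_map_atin tendsto_mult)

lemma continuous_map_cnj:
  "continuous_map X euclidean f \<Longrightarrow> continuous_map X euclidean (\<lambda>x. cnj (f x))"
  by (simp add: continuous_map_atin tendsto_cnj)

lemma cfunspace_continuous: "f \<in> cfunspace X \<Longrightarrow> continuous_map X euclidean f"
  by (simp add: cfunspace_def)

lemma restrict_in_cfunspace:
  assumes "continuous_map X euclidean f"
  shows "restrict f (topspace X) \<in> cfunspace X"
proof -
  have "continuous_map X euclidean (restrict f (topspace X))"
    using assms by (rule continuous_map_eq) auto
  then show ?thesis by (simp add: cfunspace_def)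
qed

lemma restrict_cfunspace: "f \<in> cfunspace X \<Longrightarrow> restrict f (topspace X) = f"
  by (simp add: cfunspace_def extensional_restrict)

lemma complexify_in_cfunspace: "continuous_map X euclideanreal g \<Longrightarrow> complexify X g \<in> cfunspace X"
  unfolding complexify_def by (intro restrict_in_cfunspace continuous_map_of_real)

lemma complexify_cong: "(\<And>x. x \<in> topspace X \<Longrightarrow> f x = g x) \<Longrightarrow> complexify X f = complexify X g"
  by (auto simp: complexify_def)

lemma clinear_functional_add:
  assumes "clinear_functional X \<phi>" "continuous_map X euclidean f" "continuous_map X euclidean g"
  shows "\<phi> (\<lambda>x\<in>topspace X. f x + g x) = \<phi> (restrict f (topspace X)) + \<phi> (restrict g (topspace X))"
proof -
  have "(\<lambda>x\<in>topspace X. f x + g x) =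
      (\<lambda>x\<in>topspace X. restrict f (topspace X) x + restrict g (topspace X) x)"
    by auto
  then show ?thesis
    using assms restrict_in_cfunspace[of X f] restrict_in_cfunspace[of X g]
    unfolding clinear_functional_def by metis
qed

lemma clinear_functional_scale:
  assumes "clinear_functional X \<phi>" "continuous_map X euclidean f"
  shows "\<phi> (\<lambda>x\<in>topspace X. c * f x) = c * \<phi> (restrict f (topspace X))"
proof -
  have "(\<lambda>x\<in>topspace X. c * f x) = (\<lambda>x\<in>topspace X. c * restrict f (topspace X) x)"
    by auto
  then show ?thesis
    using assms restrict_in_cfunspace[of X f] unfolding clinear_functional_def by metis
qed

lemma clinear_functional_complexify_add:
  assumes "clinear_functional X \<phi>" "continuous_map X euclideanreal f" "continuous_map X euclideanreal g"
  shows "\<phi> (complexify X (\<lambda>x. f x + g x)) = \<phi> (complexify X f) + \<phi> (complexify X g)"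
  using clinear_functional_add[OF assms(1) continuous_map_of_real[OF assms(2)] continuous_map_of_real[OF assms(3)]]
  by (simp add: complexify_def)

lemma clinear_functional_complexify_scale:
  assumes "clinear_functional X \<phi>" "continuous_map X euclideanreal f"
  shows "\<phi> (complexify X (\<lambda>x. c * f x)) = of_real c * \<phi> (complexify X f)"
  using clinear_functional_scale[OF assms(1) continuous_map_of_real[OF assms(2)], of "of_real c"]
  by (simp add: complexify_def)

lemma clinear_functional_Re_Im:
  assumes \<phi>: "clinear_functional X \<phi>" and f: "continuous_map X euclidean f"
  shows "\<phi> (restrict f (topspace X)) =
    \<phi> (complexify X (\<lambda>x. Re (f x))) + \<i> * \<phi> (complexify X (\<lambda>x. Im (f x)))"
proof -
  note c = continuous_map_Re_Im[OF f, THEN continuous_map_of_real]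
  have "restrict f (topspace X) =
      (\<lambda>x\<in>topspace X. of_real (Re (f x)) + \<i> * of_real (Im (f x)))"
    by (auto simp: complex_eq)
  moreover have "continuous_map X euclidean (\<lambda>x. \<i> * complex_of_real (Im (f x)))"
    using c by (intro continuous_map_complex_mult) auto
  ultimately have "\<phi> (restrict f (topspace X)) = \<phi> (complexify X (\<lambda>x. Re (f x))) +
      \<phi> (\<lambda>x\<in>topspace X. \<i> * of_real (Im (f x)))"
    using clinear_functional_add[OF \<phi> c(1)] by (simp add: complexify_def)
  also have "\<phi> (\<lambda>x\<in>topspace X. \<i> * of_real (Im (f x))) = \<i> * \<phi> (complexify X (\<lambda>x. Im (f x)))"
    using clinear_functional_scale[OF \<phi> c(2)] by (simp add: complexify_def)
  finally show ?thesis .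
qed

lemma positive_functional_complexify:
  assumes \<phi>: "positive_functional X \<phi>" and g: "continuous_map X euclideanreal g"
    and nonneg: "\<And>x. x \<in> topspace X \<Longrightarrow> 0 \<le> g x"
  shows "\<phi> (complexify X g) \<in> \<real>\<^sub>\<ge>\<^sub>0"
proof -
  have "continuous_map X euclideanreal (\<lambda>x. sqrt (g x))"
    using g by (simp add: continuous_map_atin tendsto_real_sqrt)
  then have "complexify X (\<lambda>x. sqrt (g x)) \<in> cfunspace X" by (rule complexify_in_cfunspace)
  moreover have "complexify X g =
      (\<lambda>x\<in>topspace X. cnj (complexify X (\<lambda>x. sqrt (g x)) x) * complexify X (\<lambda>x. sqrt (g x)) x)"
    using nonneg by (auto simp: complexify_def simp flip: of_real_mult)
  ultimately show ?thesis using \<phi> by (simp add: positive_functional_def)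
qed

lemma positive_functional_complexify_real:
  assumes lin: "clinear_functional X \<phi>" and pos: "positive_functional X \<phi>"
    and g: "continuous_map X euclideanreal g"
  shows "\<phi> (complexify X g) \<in> \<real>"
proof -
  let ?p = "\<lambda>x. max (g x) 0" and ?n = "\<lambda>x. max (- g x) 0"
  have c: "continuous_map X euclideanreal ?p" "continuous_map X euclideanreal ?n"
    using g by (auto intro!: continuous_intros)
  have "complexify X g = complexify X (\<lambda>x. ?p x + (-1) * ?n x)"
    by (intro complexify_cong) (auto simp: max_def)
  then have "\<phi> (complexify X g) = \<phi> (complexify X (\<lambda>x. ?p x + (-1) * ?n x))" by simp
  also have "\<dots> = \<phi> (complexify X ?p) + of_real (-1) * \<phi> (complexify X ?n)"
    using c by (simp only: clinear_functional_complexify_add[OF lin] continuous_map_real_mult_left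
        clinear_functional_complexify_scale[OF lin])
  finally show ?thesis
    using positive_functional_complexify[OF pos c(1)] positive_functional_complexify[OF pos c(2)]
    by (auto simp: complex_nonneg_Reals_iff complex_is_Real_iff)
qed

text \<open>
  Rotating by a unimodular \<open>u\<close> makes \<open>u \<phi> f\<close> equal to \<open>\<bar>\<phi> f\<bar>\<close>, which is then the value at the real
  function \<open>Re (u f) \<le> B\<close>.
\<close>

lemma positive_functional_bound:
  assumes lin: "clinear_functional X \<phi>" and pos: "positive_functional X \<phi>"
    and f: "f \<in> cfunspace X" and B: "\<And>x. x \<in> topspace X \<Longrightarrow> cmod (f x) \<le> B"
  shows "cmod (\<phi> f) \<le> B * Re (\<phi> (\<lambda>x\<in>topspace X. 1))"
proof -
  obtain u where u: "cmod u = 1" "u * \<phi> f = of_real (cmod (\<phi> f))"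
  proof (cases "\<phi> f = 0")
    case True
    then show ?thesis using that[of 1] by simp
  next
    case False
    have "cnj (\<phi> f) / of_real (cmod (\<phi> f)) * \<phi> f = of_real ((cmod (\<phi> f))\<^sup>2) / of_real (cmod (\<phi> f))"
      by (simp only: complex_norm_square) simp
    also have "\<dots> = of_real (cmod (\<phi> f))"
      using False by (simp add: power2_eq_square)
    finally show ?thesis
      using that[of "cnj (\<phi> f) / of_real (cmod (\<phi> f))"] False by (simp add: norm_divide)
  qed
  define g where "g = (\<lambda>x. Re (u * f x))"
  have fc: "continuous_map X euclidean f" using f by (rule cfunspace_continuous)
  have uf: "continuous_map X euclidean (\<lambda>x. u * f x)"
    using fc by (intro continuous_map_complex_mult) auto
  have g: "continuous_map X euclideanreal g" unfolding g_def using uf by (rule continuous_map_Re_Im)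
  have "of_real (cmod (\<phi> f)) = \<phi> (\<lambda>x\<in>topspace X. u * f x)"
    using clinear_functional_scale[OF lin fc, of u] u restrict_cfunspace[OF f] by simp
  also have "\<dots> = \<phi> (complexify X g) + \<i> * \<phi> (complexify X (\<lambda>x. Im (u * f x)))"
    using clinear_functional_Re_Im[OF lin uf] by (simp add: g_def)
  finally have "cmod (\<phi> f) = Re (\<phi> (complexify X g) + \<i> * \<phi> (complexify X (\<lambda>x. Im (u * f x))))"
    by (metis Re_complex_of_real)
  also have "\<dots> = Re (\<phi> (complexify X g))"
    using positive_functional_complexify_real[OF lin pos continuous_map_Re_Im(2)[OF uf]]
    by (auto simp: complex_is_Real_iff)
  also have "\<dots> \<le> B * Re (\<phi> (complexify X (\<lambda>_. 1)))"
  proof -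
    have "\<phi> (complexify X (\<lambda>x. B * 1 + (-1) * g x)) \<in> \<real>\<^sub>\<ge>\<^sub>0"
    proof (rule positive_functional_complexify[OF pos])
      show "continuous_map X euclideanreal (\<lambda>x. B * 1 + (-1) * g x)"
        using g by (intro continuous_map_add continuous_map_real_mult_left) auto
      fix x assume "x \<in> topspace X"
      then have "cmod (u * f x) \<le> B" using B u by (simp add: norm_mult)
      then show "0 \<le> B * 1 + (-1) * g x"
        using complex_Re_le_cmod[of "u * f x"] by (simp add: g_def)
    qed
    also have "\<phi> (complexify X (\<lambda>x. B * 1 + (-1) * g x)) =
        \<phi> (complexify X (\<lambda>x. B * 1)) + \<phi> (complexify X (\<lambda>x. (-1) * g x))"
      using g by (intro clinear_functional_complexify_add[OF lin] continuous_map_real_mult_left) auto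
    also have "\<phi> (complexify X (\<lambda>x. B * 1)) = of_real B * \<phi> (complexify X (\<lambda>_. 1))"
      by (intro clinear_functional_complexify_scale[OF lin]) auto
    also have "\<phi> (complexify X (\<lambda>x. (-1) * g x)) = of_real (-1) * \<phi> (complexify X g)"
      using g by (rule clinear_functional_complexify_scale[OF lin])
    finally show ?thesis by (auto simp: complex_nonneg_Reals_iff)
  qed
  finally show ?thesis by (simp add: complexify_def)
qed

text \<open>
  For a positive functional the norm is the value at the unit. In this form the conditions on a state
  are visibly closed under pointwise limits.
\<close>

lemma states_iff:
  "\<phi> \<in> states X \<longleftrightarrow> \<phi> \<in> extensional (cfunspace X) \<and> clinear_functional X \<phi> \<and>
     positive_functional X \<phi> \<and> \<phi> (\<lambda>x\<in>topspace X. 1) = 1"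
proof -
  have *: "bdd_above (unit_ball_values X \<phi>)"
    "Sup (unit_ball_values X \<phi>) = 1 \<longleftrightarrow> \<phi> (\<lambda>x\<in>topspace X. 1) = 1"
    if lin: "clinear_functional X \<phi>" and pos: "positive_functional X \<phi>"
  proof -
    let ?e = "\<lambda>x\<in>topspace X. 1 :: complex"
    have le: "r \<le> Re (\<phi> ?e)" if "r \<in> unit_ball_values X \<phi>" for r
      using that positive_functional_bound[OF lin pos, of _ 1] by (auto simp: unit_ball_values_def)
    have e: "\<phi> ?e \<in> \<real>\<^sub>\<ge>\<^sub>0"
      using positive_functional_complexify[OF pos, of "\<lambda>_. 1"] by (simp add: complexify_def)
    then have norm: "cmod (\<phi> ?e) = Re (\<phi> ?e)" and e_eq: "\<phi> ?e = of_real (Re (\<phi> ?e))"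
      by (auto simp: complex_nonneg_Reals_iff cmod_eq_Re complex_eq_iff)
    show "bdd_above (unit_ball_values X \<phi>)" using le by (rule bdd_aboveI)
    have "?e \<in> cfunspace X" by (intro restrict_in_cfunspace) auto
    then have "cmod (\<phi> ?e) \<in> unit_ball_values X \<phi>"
      unfolding unit_ball_values_def by (intro CollectI exI[of _ ?e]) auto
    then have "Sup (unit_ball_values X \<phi>) = Re (\<phi> ?e)"
      using le unfolding norm by (rule cSup_eq_maximum)
    then show "Sup (unit_ball_values X \<phi>) = 1 \<longleftrightarrow> \<phi> ?e = 1"
      using e_eq by (metis Re_complex_of_real of_real_1)
  qed
  then show ?thesis by (auto simp: states_def)
qed

lemma closedin_Collect_ball:
  assumes "\<And>i. i \<in> A \<Longrightarrow> closedin T {x \<in> topspace T. Q i x}"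
  shows "closedin T {x \<in> topspace T. \<forall>i\<in>A. Q i x}"
proof (cases "A = {}")
  case False
  then have "{x \<in> topspace T. \<forall>i\<in>A. Q i x} = (\<Inter>i\<in>A. {x \<in> topspace T. Q i x})" by auto
  then show ?thesis using False assms by (auto intro: closedin_INT)
qed auto

lemma closedin_Collect_conj:
  assumes "closedin T {x \<in> topspace T. Q x}" "closedin T {x \<in> topspace T. R x}"
  shows "closedin T {x \<in> topspace T. Q x \<and> R x}"
proof -
  have "{x \<in> topspace T. Q x \<and> R x} = {x \<in> topspace T. Q x} \<inter> {x \<in> topspace T. R x}" by auto
  then show ?thesis using assms by (metis closedin_Int)
qed

lemma closedin_states:
  "closedin (product_topology (\<lambda>_. euclidean) (cfunspace X)) (states X)"
proof -
  let ?P = "product_topology (\<lambda>_. euclidean) (cfunspace X) :: (('a \<Rightarrow> complex) \<Rightarrow> complex) topology"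
  have eval: "continuous_map ?P euclidean (\<lambda>\<phi>. \<phi> f)" if "f \<in> cfunspace X" for f
    using that by (rule continuous_map_product_projection)
  have cl0: "closedin ?P {\<phi> \<in> topspace ?P. h \<phi> \<in> S}"
    if "continuous_map ?P euclidean h" "closed S" for h :: "_ \<Rightarrow> complex" and S
    using that by (intro closedin_continuous_map_preimage) auto
  have mem: "(\<lambda>x\<in>topspace X. f x + g x) \<in> cfunspace X" "(\<lambda>x\<in>topspace X. c * f x) \<in> cfunspace X"
    "(\<lambda>x\<in>topspace X. cnj (f x) * f x) \<in> cfunspace X"
    if "f \<in> cfunspace X" "g \<in> cfunspace X" for f g c
  proof -
    have f: "continuous_map X euclidean f" and g: "continuous_map X euclidean g"
      using that by (auto dest: cfunspace_continuous)
    moreover have "continuous_map X euclidean (\<lambda>x. cnj (f x))"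
      using f by (rule continuous_map_cnj)
    ultimately show "(\<lambda>x\<in>topspace X. f x + g x) \<in> cfunspace X" "(\<lambda>x\<in>topspace X. c * f x) \<in> cfunspace X"
      "(\<lambda>x\<in>topspace X. cnj (f x) * f x) \<in> cfunspace X"
      by (auto intro!: restrict_in_cfunspace continuous_map_add continuous_map_complex_mult)
  qed
  have one: "(\<lambda>x\<in>topspace X. 1) \<in> cfunspace X" by (intro restrict_in_cfunspace) auto
  have "states X = {\<phi> \<in> topspace ?P.
     (\<forall>f\<in>cfunspace X. \<forall>g\<in>cfunspace X. \<phi> (\<lambda>x\<in>topspace X. f x + g x) - (\<phi> f + \<phi> g) \<in> {0}) \<and>
     (\<forall>c\<in>UNIV. \<forall>f\<in>cfunspace X. \<phi> (\<lambda>x\<in>topspace X. c * f x) - c * \<phi> f \<in> {0}) \<and>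
     (\<forall>f\<in>cfunspace X. \<phi> (\<lambda>x\<in>topspace X. cnj (f x) * f x) \<in> \<real>\<^sub>\<ge>\<^sub>0) \<and>
     \<phi> (\<lambda>x\<in>topspace X. 1) \<in> {1}}"
    by (auto simp: states_iff clinear_functional_def positive_functional_def PiE_def)
  also have "closedin ?P \<dots>"
    by (intro closedin_Collect_conj closedin_Collect_ball cl0 continuous_map_diff continuous_map_add
        continuous_map_complex_mult eval mem one closed_singleton closed_nonneg_Reals_complex) auto
  finally show ?thesis .
qed

text \<open>
  Banach--Alaoglu: the states form a closed subset of a product of discs.
\<close>

lemma compact_space_state_space:
  assumes X: "compact_space X"
  shows "compact_space (state_space X)"
proof -
  let ?P = "product_topology (\<lambda>_. euclidean) (cfunspace X) :: (('a \<Rightarrow> complex) \<Rightarrow> complex) topology"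
  have "\<exists>B. \<forall>x\<in>topspace X. cmod (f x) \<le> B" if "f \<in> cfunspace X" for f
    using continuous_map_compact_space_bounded[OF X cfunspace_continuous[OF that]] by blast
  then obtain B where B: "\<And>f x. f \<in> cfunspace X \<Longrightarrow> x \<in> topspace X \<Longrightarrow> cmod (f x) \<le> B f"
    by metis
  have "states X \<subseteq> (\<Pi>\<^sub>E f\<in>cfunspace X. cball 0 (B f))"
  proof
    fix \<phi> assume \<phi>: "\<phi> \<in> states X"
    then have "cmod (\<phi> f) \<le> B f" if "f \<in> cfunspace X" for f
      using positive_functional_bound[of X \<phi> f "B f"] that B by (auto simp: states_iff)
    then show "\<phi> \<in> (\<Pi>\<^sub>E f\<in>cfunspace X. cball 0 (B f))"
      using \<phi> by (auto simp: states_iff PiE_def)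
  qed
  moreover have "compactin ?P (\<Pi>\<^sub>E f\<in>cfunspace X. cball 0 (B f))"
    by (simp add: compactin_PiE)
  ultimately have "compactin ?P (states X)"
    using closedin_states closed_compactin by blast
  then show ?thesis unfolding state_space_def by (rule compact_space_subtopology)
qed

lemma Hausdorff_space_state_space: "Hausdorff_space (state_space X)"
  unfolding state_space_def
  by (intro Hausdorff_space_subtopology) (simp add: Hausdorff_space_product_topology)

lemma continuous_map_state_space_eval:
  "f \<in> cfunspace X \<Longrightarrow> continuous_map (state_space X) euclidean (\<lambda>\<phi>. \<phi> f)"
  unfolding state_space_def
  by (intro continuous_map_from_subtopology continuous_map_product_projection)

lemma normalized_positive_functional_state:
  assumes "compact_space X" "Hausdorff_space X" and \<phi>: "\<phi> \<in> states X"
  shows "normalized_positive_functional X (\<lambda>g. Re (\<phi> (complexify X g)))"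
proof
  have lin: "clinear_functional X \<phi>" and pos: "positive_functional X \<phi>" and one: "\<phi> (\<lambda>x\<in>topspace X. 1) = 1"
    using \<phi> by (auto simp: states_iff)
  show "Re (\<phi> (complexify X (\<lambda>_. 1))) = 1" using one by (simp add: complexify_def)
  fix f g c assume f: "continuous_map X euclideanreal f"
  show "Re (\<phi> (complexify X (\<lambda>x. c * f x))) = c * Re (\<phi> (complexify X f))"
    using clinear_functional_complexify_scale[OF lin f] by simp
  show "0 \<le> Re (\<phi> (complexify X f))" if "\<And>x. x \<in> topspace X \<Longrightarrow> 0 \<le> f x"
    using positive_functional_complexify[OF pos f] that by (simp add: complex_nonneg_Reals_iff)
  assume g: "continuous_map X euclideanreal g"
  show "Re (\<phi> (complexify X (\<lambda>x. f x + g x))) = Re (\<phi> (complexify X f)) + Re (\<phi> (complexify X g))"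
    using clinear_functional_complexify_add[OF lin f g] by simp
qed fact+

section \<open>Faces and supports\<close>

lemma regular_borel_probsD:
  assumes "M \<in> regular_borel_probs X"
  shows "prob_space M" "sets M = sets (sigma (topspace X) {U. openin X U})"
    "space M = topspace X" "openin X U \<Longrightarrow> U \<in> sets M"
proof -
  show "prob_space M" and s: "sets M = sets (sigma (topspace X) {U. openin X U})"
    using assms by (auto simp: regular_borel_probs_def)
  show "space M = topspace X"
    using sets_eq_imp_space_eq[OF s] by (simp add: space_measure_of_conv)
  show "openin X U \<Longrightarrow> U \<in> sets M"
    unfolding s by (subst sets_measure_of) (auto dest: openin_subset)
qed

lemma integrable_regular_borel_prob:
  fixes f :: "'a \<Rightarrow> 'b :: {banach, second_countable_topology}"
  assumes "compact_space X" "M \<in> regular_borel_probs X" "continuous_map X euclidean f"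
  shows "integrable M f"
  using assms regular_borel_probsD[OF assms(2)]
  by (intro integrable_continuous_map_compact_space[of X]) (auto intro: prob_space.finite_measure)

lemma ex_represents:
  assumes X: "compact_space X" "Hausdorff_space X" and \<phi>: "\<phi> \<in> states X"
  shows "\<exists>M. represents X M \<phi>"
proof -
  have lin: "clinear_functional X \<phi>" and pos: "positive_functional X \<phi>"
    using \<phi> by (auto simp: states_iff)
  interpret R: normalized_positive_functional X "\<lambda>g. Re (\<phi> (complexify X g))"
    using assms by (rule normalized_positive_functional_state)
  have real: "\<phi> (complexify X g) = of_real (integral\<^sup>L R.riesz_measure g)"
    if "continuous_map X euclideanreal g" for g
    using R.riesz_representation[OF that] positive_functional_complexify_real[OF lin pos that]
    by (metis of_real_Re)
  have "\<phi> f = integral\<^sup>L R.riesz_measure f" if f: "f \<in> cfunspace X" for f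
  proof -
    have fc: "continuous_map X euclidean f" using f by (rule cfunspace_continuous)
    have int: "integrable R.riesz_measure f"
      using X(1) R.riesz_measure_regular fc by (rule integrable_regular_borel_prob)
    have "\<phi> f = of_real (integral\<^sup>L R.riesz_measure (\<lambda>x. Re (f x))) +
        \<i> * of_real (integral\<^sup>L R.riesz_measure (\<lambda>x. Im (f x)))"
      using clinear_functional_Re_Im[OF lin fc] real continuous_map_Re_Im[OF fc]
      by (simp add: restrict_cfunspace[OF f])
    also have "\<dots> = integral\<^sup>L R.riesz_measure f"
      using int by (simp add: complex_eq_iff)
    finally show ?thesis .
  qed
  then show ?thesis
    using R.riesz_measure_regular by (auto simp: represents_def)
qed

text \<open>
  A compact set off the support is covered by finitely many null open sets; inner regularity passes
  this on to the complement of \<open>K\<close>, which itself need not be a countable union of null open sets.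
\<close>

lemma AE_in_closed_if_supp_subset:
  assumes M: "M \<in> regular_borel_probs X" and K: "closedin X K" and supp: "supp X M \<subseteq> K"
  shows "AE x in M. x \<in> K"
proof -
  note M' = regular_borel_probsD[OF M]
  have op: "openin X (topspace X - K)" using K by auto
  have "emeasure M C \<le> 0" if C: "compactin X C" "C \<subseteq> topspace X - K" for C
  proof -
    have "\<exists>U. openin X U \<and> x \<in> U \<and> emeasure M U = 0" if "x \<in> C" for x
    proof -
      have "x \<in> topspace X" "x \<notin> supp X M" using that C supp by auto
      then show ?thesis by (auto simp: supp_def)
    qed
    then obtain U where U: "\<And>x. x \<in> C \<Longrightarrow> openin X (U x) \<and> x \<in> U x \<and> emeasure M (U x) = 0"
      by metis
    have "\<exists>D. finite D \<and> D \<subseteq> C \<and> C \<subseteq> (\<Union>x\<in>D. U x)"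
      using U by (intro compactin_finite_subcover[OF C(1)]) auto
    then obtain D where D: "finite D" "D \<subseteq> C" "C \<subseteq> (\<Union>x\<in>D. U x)" by blast
    have "U x \<in> null_sets M" if "x \<in> D" for x
      using U[of x] D that M'(4) by (intro null_setsI) auto
    then have "(\<Union>x\<in>D. U x) \<in> null_sets M"
      using D by (intro null_sets.finite_UN) auto
    then have "emeasure M (\<Union>x\<in>D. U x) = 0" "(\<Union>x\<in>D. U x) \<in> sets M"
      by (auto dest: null_setsD1 null_setsD2)
    moreover from this(2) have "emeasure M C \<le> emeasure M (\<Union>x\<in>D. U x)"
      using D(3) by (intro emeasure_mono)
    ultimately show ?thesis by simp
  qed
  then have "(SUP C\<in>{C. compactin X C \<and> C \<subseteq> topspace X - K}. emeasure M C) \<le> 0"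
    by (intro SUP_least) auto
  moreover have "emeasure M (topspace X - K) =
      (SUP C\<in>{C. compactin X C \<and> C \<subseteq> topspace X - K}. emeasure M C)"
    using M M'(4)[OF op] unfolding regular_borel_probs_def by blast
  ultimately have "topspace X - K \<in> null_sets M"
    using M'(4)[OF op] by (auto simp: null_sets_def)
  then show ?thesis
    by (rule AE_I') (auto simp: M'(3))
qed

lemma represents_complexify:
  assumes X: "compact_space X" and M: "represents X M \<phi>" and g: "continuous_map X euclideanreal g"
  shows "integrable M g" "\<phi> (complexify X g) = of_real (integral\<^sup>L M g)"
proof -
  have reg: "M \<in> regular_borel_probs X" using M by (simp add: represents_def)
  show "integrable M g" using X reg g by (rule integrable_regular_borel_prob)
  have "\<phi> (complexify X g) = integral\<^sup>L M (complexify X g)"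
    using M complexify_in_cfunspace[OF g] by (simp add: represents_def)
  also have "\<dots> = integral\<^sup>L M (\<lambda>x. of_real (g x))"
    by (intro Bochner_Integration.integral_cong) (auto simp: complexify_def regular_borel_probsD[OF reg])
  finally show "\<phi> (complexify X g) = of_real (integral\<^sup>L M g)" by simp
qed

lemma face_le:
  assumes X: "compact_space X" and K: "closedin X K" and \<phi>: "\<phi> \<in> face X K"
    and g: "continuous_map X euclideanreal g" and le: "\<And>x. x \<in> K \<Longrightarrow> g x \<le> c"
  shows "Re (\<phi> (complexify X g)) \<le> c"
proof -
  obtain M where M: "represents X M \<phi>" "supp X M \<subseteq> K" using \<phi> by (auto simp: face_def)
  then have reg: "M \<in> regular_borel_probs X" by (simp add: represents_def)
  have "AE x in M. g x \<le> c"
    using AE_in_closed_if_supp_subset[OF reg K M(2)] by eventually_elim (rule le)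
  then show ?thesis
    using represents_complexify[OF X M(1) g] regular_borel_probsD(1)[OF reg]
    by (simp add: prob_space.integral_le_const)
qed

lemma compact_Hausdorff_separating_function:
  assumes X: "compact_space X" "Hausdorff_space X" and K: "closedin X K"
    and x: "x \<in> topspace X" "x \<notin> K"
  obtains g where "continuous_map X euclideanreal g" "\<And>y. y \<in> topspace X \<Longrightarrow> 0 \<le> g y"
    "\<And>y. y \<in> K \<Longrightarrow> g y = 0" "g x = (1 :: real)"
proof -
  have "closedin X {x}"
    using X(2) x by (simp add: closedin_Hausdorff_singleton)
  moreover have "normal_space X"
    using X compact_Hausdorff_or_regular_imp_normal_space by blast
  ultimately obtain g where "continuous_map X (top_of_set {0..1::real}) g" "g ` K \<subseteq> {0}" "g ` {x} \<subseteq> {1}"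
    using Urysohn_lemma[of X K "{x}" 0 1] K x by (auto simp: disjnt_def)
  then show ?thesis
    by (intro that[of g]) (auto simp: continuous_map_in_subtopology)
qed

text \<open>
  This description of a face no longer mentions measures: it shows that a face is weak* closed, and
  makes membership easy to check. One inclusion needs the Riesz measure of a state and Urysohn's
  lemma: a positive function that vanishes on \<open>K\<close> and is \<open>1\<close> at a point of the support has positive
  integral.
\<close>

lemma face_eq:
  assumes X: "compact_space X" "Hausdorff_space X" and K: "closedin X K"
  shows "face X K = {\<phi> \<in> states X. \<forall>g. continuous_map X euclideanreal g \<and>
    (\<forall>x\<in>topspace X. 0 \<le> g x) \<and> (\<forall>x\<in>K. g x = 0) \<longrightarrow> \<phi> (complexify X g) = 0}" (is "_ = ?F")
proof (intro equalityI subsetI)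
  fix \<phi> assume \<phi>: "\<phi> \<in> face X K"
  then have st: "\<phi> \<in> states X" by (simp add: face_def)
  have "\<phi> (complexify X g) = 0"
    if g: "continuous_map X euclideanreal g" "\<forall>x\<in>topspace X. 0 \<le> g x" "\<forall>x\<in>K. g x = 0" for g
  proof -
    have "\<phi> (complexify X g) \<in> \<real>\<^sub>\<ge>\<^sub>0"
      using st g by (intro positive_functional_complexify) (auto simp: states_iff)
    moreover have "Re (\<phi> (complexify X g)) \<le> 0"
      using face_le[OF X(1) K \<phi> g(1), of 0] g(3) by simp
    ultimately show ?thesis by (auto simp: complex_nonneg_Reals_iff complex_eq_iff)
  qed
  then show "\<phi> \<in> ?F" using st by auto
next
  fix \<phi> assume \<phi>: "\<phi> \<in> ?F"
  then obtain M where M: "represents X M \<phi>" using ex_represents[OF X] by blast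
  then have reg: "M \<in> regular_borel_probs X" by (simp add: represents_def)
  note M' = regular_borel_probsD[OF reg]
  interpret prob_space M by (rule M')
  have "x \<in> K" if x: "x \<in> supp X M" for x
  proof (rule ccontr)
    assume "x \<notin> K"
    have xt: "x \<in> topspace X" using x by (simp add: supp_def)
    obtain g where gc: "continuous_map X euclideanreal g" and g0: "\<And>y. y \<in> topspace X \<Longrightarrow> 0 \<le> g y"
      and gK: "\<And>y. y \<in> K \<Longrightarrow> g y = 0" and gx: "g x = 1"
      using compact_Hausdorff_separating_function[OF X K xt \<open>x \<notin> K\<close>] by blast
    define V where "V = {x \<in> topspace X. 1/2 < g x}"
    have V: "openin X V"
      unfolding V_def using openin_continuous_map_preimage[OF gc, of "{1/2<..}"] by simp
    moreover have "x \<in> V" using gx xt by (simp add: V_def)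
    ultimately have "0 < emeasure M V" using x by (auto simp: supp_def)
    then have "0 < (1/2) * prob V" by (simp add: emeasure_eq_measure)
    also have "(1/2) * prob V = integral\<^sup>L M (\<lambda>x. (1/2) * indicator V x)"
      using M'(4)[OF V] by simp
    also have "\<dots> \<le> integral\<^sup>L M g"
    proof (rule integral_mono)
      show "integrable M (\<lambda>x. (1/2) * indicator V x :: real)"
        using M'(4)[OF V] by (auto intro!: integrable_real_indicator simp: emeasure_eq_measure)
      show "integrable M g" using represents_complexify(1)[OF X(1) M gc] .
      show "1/2 * indicator V y \<le> g y" if "y \<in> space M" for y
        using g0[of y] that by (auto simp: indicator_def V_def M'(3))
    qed
    finally have "\<phi> (complexify X g) \<noteq> 0"
      using represents_complexify(2)[OF X(1) M gc] by simp
    then show False using \<phi> gc g0 gK by blast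
  qed
  then show "\<phi> \<in> face X K" using \<phi> M by (auto simp: face_def)
qed

lemma closedin_face:
  assumes X: "compact_space X" "Hausdorff_space X" and K: "closedin X K"
  shows "closedin (state_space X) (face X K)"
proof -
  let ?G = "{g. continuous_map X euclideanreal g \<and> (\<forall>x\<in>topspace X. 0 \<le> g x) \<and> (\<forall>x\<in>K. g x = 0)}"
  have "face X K = {\<phi> \<in> topspace (state_space X). \<forall>g\<in>?G. \<phi> (complexify X g) \<in> {0}}"
    using face_eq[OF X K] by (auto simp: topspace_state_space)
  also have "closedin (state_space X) \<dots>"
    by (intro closedin_Collect_ball closedin_continuous_map_preimage[OF continuous_map_state_space_eval]
        complexify_in_cfunspace) auto
  finally show ?thesis .
qed

text \<open>
  The image of a probability measure under a map \<open>s\<close> into \<open>L\<close>, as a state. Point evaluations and the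
  discrete approximations of a state used for lower semicontinuity are both of this kind.
\<close>

lemma pushforward_in_face:
  fixes M :: "'b measure" and s :: "'b \<Rightarrow> 'a"
  assumes X: "compact_space X" "Hausdorff_space X" and L: "closedin X L"
    and M: "prob_space M" and s: "\<And>x. x \<in> space M \<Longrightarrow> s x \<in> L"
    and meas: "\<And>f :: 'a \<Rightarrow> complex. (\<lambda>x. f (s x)) \<in> borel_measurable M"
  defines "\<psi> \<equiv> \<lambda>f\<in>cfunspace X. integral\<^sup>L M (\<lambda>x. f (s x))"
  shows "\<psi> \<in> face X L" "f \<in> cfunspace X \<Longrightarrow> integrable M (\<lambda>x. f (s x))"
proof -
  interpret prob_space M by (rule M)
  have st: "s x \<in> topspace X" if "x \<in> space M" for x
    using s[OF that] closedin_subset[OF L] by blast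
  have int: "integrable M (\<lambda>x. f (s x))" if f: "f \<in> cfunspace X" for f
  proof -
    obtain B where "\<And>x. x \<in> topspace X \<Longrightarrow> cmod (f x) \<le> B"
      using continuous_map_compact_space_bounded[OF X(1) cfunspace_continuous[OF f]] by blast
    then show ?thesis using meas st by (intro integrable_const_bound[of _ B]) auto
  qed
  then show "f \<in> cfunspace X \<Longrightarrow> integrable M (\<lambda>x. f (s x))" .
  have val: "\<psi> (restrict h (topspace X)) = integral\<^sup>L M (\<lambda>x. h (s x))"
    if "continuous_map X euclidean h" for h
    unfolding \<psi>_def using restrict_in_cfunspace[OF that] st
    by (auto intro!: Bochner_Integration.integral_cong)
  have add: "\<psi> (\<lambda>x\<in>topspace X. f x + g x) = \<psi> f + \<psi> g" if "f \<in> cfunspace X" "g \<in> cfunspace X" for f g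
  proof -
    have "\<psi> (\<lambda>x\<in>topspace X. f x + g x) = integral\<^sup>L M (\<lambda>x. f (s x) + g (s x))"
      using that by (intro val continuous_map_add cfunspace_continuous)
    then show ?thesis using that int by (simp add: \<psi>_def)
  qed
  have scale: "\<psi> (\<lambda>x\<in>topspace X. c * f x) = c * \<psi> f" if "f \<in> cfunspace X" for c f
  proof -
    have "\<psi> (\<lambda>x\<in>topspace X. c * f x) = integral\<^sup>L M (\<lambda>x. c * f (s x))"
      by (rule val, rule continuous_map_complex_mult) (use that cfunspace_continuous in auto)
    then show ?thesis using that int by (simp add: \<psi>_def)
  qed
  have pos: "\<psi> (\<lambda>x\<in>topspace X. cnj (f x) * f x) \<in> \<real>\<^sub>\<ge>\<^sub>0" if "f \<in> cfunspace X" for f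
  proof -
    have fc: "continuous_map X euclidean f" using that by (rule cfunspace_continuous)
    then have "continuous_map X euclidean (\<lambda>x. cnj (f x))"
      by (rule continuous_map_cnj)
    with fc have "\<psi> (\<lambda>x\<in>topspace X. cnj (f x) * f x) = integral\<^sup>L M (\<lambda>x. cnj (f (s x)) * f (s x))"
      by (intro val continuous_map_complex_mult)
    also have "\<dots> = integral\<^sup>L M (\<lambda>x. of_real ((cmod (f (s x)))\<^sup>2))"
      by (simp only: complex_norm_square mult.commute)
    also have "\<dots> = of_real (integral\<^sup>L M (\<lambda>x. (cmod (f (s x)))\<^sup>2))"
      by (rule integral_complex_of_real)
    finally show ?thesis by simp
  qed
  have one: "\<psi> (\<lambda>x\<in>topspace X. 1) = 1"
    using val[of "\<lambda>_. 1"] by (simp add: prob_space)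
  have "\<psi> \<in> states X"
    using add scale pos one
    by (auto simp: states_iff clinear_functional_def positive_functional_def \<psi>_def)
  moreover have "\<psi> (complexify X g) = 0" if "continuous_map X euclideanreal g" "\<forall>x\<in>L. g x = 0" for g
  proof -
    have "\<psi> (complexify X g) = integral\<^sup>L M (\<lambda>x. complex_of_real (g (s x)))"
      unfolding complexify_def using that by (intro val continuous_map_of_real)
    also have "\<dots> = integral\<^sup>L M (\<lambda>x. 0)"
      using that s by (intro Bochner_Integration.integral_cong) auto
    finally show ?thesis by simp
  qed
  ultimately show "\<psi> \<in> face X L" using face_eq[OF X L] by blast
qed

definition dirac :: "'a topology \<Rightarrow> 'a \<Rightarrow> ('a \<Rightarrow> complex) \<Rightarrow> complex" where
  "dirac X x = (\<lambda>f\<in>cfunspace X. f x)"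

lemma dirac_in_face_iff:
  assumes X: "compact_space X" "Hausdorff_space X" and K: "closedin X K" and x: "x \<in> topspace X"
  shows "dirac X x \<in> face X K \<longleftrightarrow> x \<in> K"
proof
  assume "x \<in> K"
  interpret prob_space "return (count_space {x}) x" by (rule prob_space_return) simp
  have "(\<lambda>f\<in>cfunspace X. integral\<^sup>L (return (count_space {x}) x) (\<lambda>x. f x)) \<in> face X K"
    by (rule pushforward_in_face(1)[OF X K]) (use \<open>x \<in> K\<close> prob_space_axioms in auto)
  moreover have "(\<lambda>f\<in>cfunspace X. integral\<^sup>L (return (count_space {x}) x) (\<lambda>x. f x)) = dirac X x"
    unfolding dirac_def by (intro restrict_ext integral_return) auto
  ultimately show "dirac X x \<in> face X K" by simp
next
  assume d: "dirac X x \<in> face X K"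
  show "x \<in> K"
  proof (rule ccontr)
    assume "x \<notin> K"
    obtain g where g: "continuous_map X euclideanreal g" "\<And>y. y \<in> K \<Longrightarrow> g y = 0" "g x = 1"
      using compact_Hausdorff_separating_function[OF X K x \<open>x \<notin> K\<close>] by blast
    have "Re (dirac X x (complexify X g)) \<le> 0"
      using g(2) by (intro face_le[OF X(1) K d g(1)]) simp
    then show False
      using g(3) x complexify_in_cfunspace[OF g(1)] by (simp add: dirac_def) (simp add: complexify_def)
  qed
qed

section \<open>Semicontinuity of the face map\<close>

text \<open>
  Upper semicontinuity. Each state outside \<open>U\<close> is separated from \<open>face X K\<close> by a continuous
  function that vanishes on \<open>K\<close> and has value above \<open>1\<close> in that state. By compactness finitely many
  such functions suffice for all states outside \<open>U\<close>, and \<open>V\<close> is the set where all of them are below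
  \<open>1\<close>: a state supported in \<open>V\<close> gives each of them a value of at most \<open>1\<close>.
\<close>

lemma face_subset_open_nbhd:
  assumes X: "compact_space X" "Hausdorff_space X" and K: "closedin X K"
    and U: "openin (state_space X) U" and sub: "face X K \<subseteq> U"
  obtains V where "openin X V" "K \<subseteq> V" "\<And>L. closedin X L \<Longrightarrow> L \<subseteq> V \<Longrightarrow> face X L \<subseteq> U"
proof -
  define W where "W g = {\<phi> \<in> topspace (state_space X). Re (\<phi> (complexify X g)) \<in> {1<..}}" for g
  let ?G = "{g. continuous_map X euclideanreal g \<and> (\<forall>x\<in>K. g x = 0)}"
  have W: "openin (state_space X) (W g)" if "g \<in> ?G" for g
  proof -
    have "complexify X g \<in> cfunspace X" using that by (intro complexify_in_cfunspace) simp
    from continuous_map_Re_Im(1)[OF continuous_map_state_space_eval[OF this]]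
    show ?thesis unfolding W_def by (rule openin_continuous_map_preimage) simp
  qed
  have "compactin (state_space X) (states X - U)"
    using U by (intro closedin_compact_space compact_space_state_space X)
      (auto simp flip: topspace_state_space)
  moreover have "states X - U \<subseteq> \<Union>(W ` ?G)"
  proof
    fix \<phi> assume \<phi>: "\<phi> \<in> states X - U"
    then have lin: "clinear_functional X \<phi>" by (simp add: states_iff)
    have "\<phi> \<notin> face X K" using \<phi> sub by auto
    then obtain g where g: "continuous_map X euclideanreal g" "\<forall>x\<in>topspace X. 0 \<le> g x"
      "\<forall>x\<in>K. g x = 0" "\<phi> (complexify X g) \<noteq> 0"
      using \<phi> face_eq[OF X K] by auto
    define r where "r = Re (\<phi> (complexify X g))"
    have "\<phi> (complexify X g) \<in> \<real>\<^sub>\<ge>\<^sub>0"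
      using \<phi> g by (intro positive_functional_complexify) (auto simp: states_iff)
    then have "0 < r"
      using g(4) by (auto simp: r_def complex_nonneg_Reals_iff complex_eq_iff)
    have "Re (\<phi> (complexify X (\<lambda>x. (2/r) * g x))) = 2"
      using clinear_functional_complexify_scale[OF lin g(1), of "2/r"] \<open>0 < r\<close> by (simp add: r_def)
    then have "\<phi> \<in> W (\<lambda>x. (2/r) * g x)" using \<phi> by (simp add: W_def topspace_state_space)
    moreover have "(\<lambda>x. (2/r) * g x) \<in> ?G"
      using continuous_map_real_mult_left[OF g(1), of "2/r"] g(3) by simp
    ultimately show "\<phi> \<in> \<Union>(W ` ?G)" by blast
  qed
  ultimately have "\<exists>G. finite G \<and> G \<subseteq> ?G \<and> states X - U \<subseteq> (\<Union>g\<in>G. W g)"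
    using W by (intro compactin_finite_subcover)
  then obtain G where G: "finite G" "G \<subseteq> ?G" "states X - U \<subseteq> (\<Union>g\<in>G. W g)" by blast
  define V where "V = (\<Inter>g\<in>G. {x \<in> topspace X. g x \<in> {..<1}}) \<inter> topspace X"
  show ?thesis
  proof (rule that)
    show "openin X V"
      unfolding V_def
      by (intro openin_INT openin_continuous_map_preimage[of _ euclideanreal]) (use G in auto)
    show "K \<subseteq> V" using G closedin_subset[OF K] by (auto simp: V_def)
    fix L assume L: "closedin X L" "L \<subseteq> V"
    show "face X L \<subseteq> U"
    proof
      fix \<phi> assume \<phi>: "\<phi> \<in> face X L"
      have "\<phi> \<notin> W g" if g: "g \<in> G" for g
      proof -
        have "Re (\<phi> (complexify X g)) \<le> 1"
        proof (rule face_le[OF X(1) L(1) \<phi>])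
          show "continuous_map X euclideanreal g" using g G by auto
          fix x assume "x \<in> L"
          then have "g x < 1" using L(2) g by (auto simp: V_def)
          then show "g x \<le> 1" by simp
        qed
        then show ?thesis by (simp add: W_def)
      qed
      then show "\<phi> \<in> U" using G \<phi> by (auto simp: face_def)
    qed
  qed
qed

lemma state_space_basic_nbhd:
  assumes U: "openin (state_space X) U" and \<phi>: "\<phi> \<in> U"
  obtains J \<epsilon> where "finite J" "J \<subseteq> cfunspace X" "\<And>f. f \<in> J \<Longrightarrow> 0 < \<epsilon> f"
    "\<And>\<psi>. \<psi> \<in> states X \<Longrightarrow> (\<And>f. f \<in> J \<Longrightarrow> cmod (\<psi> f - \<phi> f) < \<epsilon> f) \<Longrightarrow> \<psi> \<in> U"
proof -
  obtain W where W: "openin (product_topology (\<lambda>_. euclidean) (cfunspace X)) W" "U = W \<inter> states X"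
    using U unfolding state_space_def openin_subtopology by blast
  then have "\<phi> \<in> W" using \<phi> by simp
  then obtain V where V: "finite {f \<in> cfunspace X. V f \<noteq> UNIV}"
    "\<And>f. f \<in> cfunspace X \<Longrightarrow> open (V f)" "\<phi> \<in> Pi\<^sub>E (cfunspace X) V" "Pi\<^sub>E (cfunspace X) V \<subseteq> W"
    using W(1) unfolding openin_product_topology_alt by fastforce
  define J where "J = {f \<in> cfunspace X. V f \<noteq> UNIV}"
  have "\<exists>e>0. ball (\<phi> f) e \<subseteq> V f" if "f \<in> J" for f
    using V that by (intro open_contains_ball_eq[THEN iffD1]) (auto simp: J_def PiE_def)
  then obtain \<epsilon> where \<epsilon>: "\<And>f. f \<in> J \<Longrightarrow> 0 < \<epsilon> f \<and> ball (\<phi> f) (\<epsilon> f) \<subseteq> V f" by metis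
  show ?thesis
  proof (rule that[of J \<epsilon>])
    fix \<psi> assume \<psi>: "\<psi> \<in> states X" and close: "\<And>f. f \<in> J \<Longrightarrow> cmod (\<psi> f - \<phi> f) < \<epsilon> f"
    have "\<psi> f \<in> V f" if "f \<in> cfunspace X" for f
    proof (cases "f \<in> J")
      case True
      then have "\<psi> f \<in> ball (\<phi> f) (\<epsilon> f)" using close by (simp add: dist_norm norm_minus_commute)
      then show ?thesis using \<epsilon> True by blast
    qed (use that in \<open>auto simp: J_def\<close>)
    then have "\<psi> \<in> W" using V(4) \<psi> by (auto simp: states_iff PiE_def)
    then show "\<psi> \<in> U" using W \<psi> by simp
  qed (use V \<epsilon> in \<open>auto simp: J_def\<close>)
qed

text \<open>
  Lower semicontinuity. Let \<open>\<phi>\<close> in \<open>face X K \<inter> U\<close> have the measure \<open>M\<close>, and let \<open>J\<close> be the finite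
  set of functions that control the neighbourhood \<open>U\<close> of \<open>\<phi>\<close>. Finitely many open sets \<open>B\<^sub>i\<close>, on each
  of which the functions in \<open>J\<close> are almost constant, cover \<open>K\<close>. If \<open>L\<close> meets each \<open>B\<^sub>i\<close>, say in
  \<open>y\<^sub>i\<close>, then moving the points of \<open>B\<^sub>i\<close> to \<open>y\<^sub>i\<close> transports \<open>M\<close> to a measure on \<open>L\<close> whose state
  differs little from \<open>\<phi>\<close> on \<open>J\<close>.
\<close>

lemma face_meets_open_nbhd:
  assumes X: "compact_space X" "Hausdorff_space X" and K: "closedin X K"
    and U: "openin (state_space X) U" and meets: "face X K \<inter> U \<noteq> {}"
  obtains n :: nat and B where "\<And>i. i < n \<Longrightarrow> openin X (B i) \<and> K \<inter> B i \<noteq> {}"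
    "\<And>L. closedin X L \<Longrightarrow> L \<noteq> {} \<Longrightarrow> (\<And>i. i < n \<Longrightarrow> L \<inter> B i \<noteq> {}) \<Longrightarrow> face X L \<inter> U \<noteq> {}"
proof -
  obtain \<phi> where \<phi>: "\<phi> \<in> face X K" "\<phi> \<in> U" using meets by blast
  obtain J \<epsilon> where J: "finite J" "J \<subseteq> cfunspace X" "\<And>f. f \<in> J \<Longrightarrow> 0 < \<epsilon> f"
    and basic: "\<And>\<psi>. \<psi> \<in> states X \<Longrightarrow> (\<And>f. f \<in> J \<Longrightarrow> cmod (\<psi> f - \<phi> f) < \<epsilon> f) \<Longrightarrow> \<psi> \<in> U"
    using state_space_basic_nbhd[OF U \<phi>(2)] by blast
  obtain M where M: "represents X M \<phi>" "supp X M \<subseteq> K" using \<phi>(1) by (auto simp: face_def)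
  then have reg: "M \<in> regular_borel_probs X" by (simp add: represents_def)
  note M' = regular_borel_probsD[OF reg]
  interpret prob_space M by (rule M')
  define C where "C p = (\<Inter>f\<in>J. {x \<in> topspace X. f x \<in> ball (f p) (\<epsilon> f / 4)}) \<inter> topspace X" for p
  have C: "openin X (C p)" for p
    unfolding C_def
    by (intro openin_INT openin_continuous_map_preimage[of _ euclidean])
      (use J cfunspace_continuous in auto)
  have pC: "p \<in> C p" if "p \<in> K" for p
    using that closedin_subset[OF K] J(3) by (auto simp: C_def)
  have "compactin X K" using X K by (simp add: closedin_compact_space)
  moreover have "K \<subseteq> \<Union>(C ` K)" using pC by blast
  ultimately have "\<exists>P. finite P \<and> P \<subseteq> K \<and> K \<subseteq> (\<Union>p\<in>P. C p)"
    using C by (intro compactin_finite_subcover)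
  then obtain P where P: "finite P" "P \<subseteq> K" "K \<subseteq> (\<Union>p\<in>P. C p)" by blast
  obtain p and n :: nat where p: "P = p ` {i. i < n}"
    using P(1) unfolding finite_conv_nat_seg_image by blast
  define B where "B i = C (p i)" for i
  have pK: "p i \<in> K" if "i < n" for i using p P(2) that by blast
  have KB: "\<exists>i<n. x \<in> B i" if "x \<in> K" for x
    using P(3) p that by (auto simp: B_def)
  show ?thesis
  proof (rule that[of n B])
    show "openin X (B i) \<and> K \<inter> B i \<noteq> {}" if "i < n" for i
      using C pC[OF pK[OF that]] pK[OF that] by (auto simp: B_def)
    fix L assume L: "closedin X L" "L \<noteq> {}" "\<And>i. i < n \<Longrightarrow> L \<inter> B i \<noteq> {}"
    have "\<exists>y. y \<in> L \<and> (i < n \<longrightarrow> y \<in> B i)" for i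
      using L(2) L(3)[of i] by blast
    then obtain y where y: "\<And>i. y i \<in> L" "\<And>i. i < n \<Longrightarrow> y i \<in> B i" by metis
    \<comment> \<open>The alternative \<open>n \<le> i\<close> makes the minimum exist off the union of the \<open>B\<^sub>i\<close> as well.\<close>
    define j where "j x = (LEAST i. n \<le> i \<or> x \<in> B i)" for x
    define s where "s x = y (j x)" for x
    have j_meas: "j \<in> measurable M (count_space UNIV)"
      unfolding j_def using C M'(4) by (intro measurable_Least) (simp add: B_def)
    have meas: "(\<lambda>x. f (s x)) \<in> borel_measurable M" for f :: "'a \<Rightarrow> complex"
      unfolding s_def by (rule measurable_compose[OF j_meas]) simp
    define \<psi> where "\<psi> = (\<lambda>f\<in>cfunspace X. integral\<^sup>L M (\<lambda>x. f (s x)))"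
    have \<psi>: "\<psi> \<in> face X L" and int_s: "\<And>f. f \<in> cfunspace X \<Longrightarrow> integrable M (\<lambda>x. f (s x))"
      unfolding \<psi>_def
      by (rule pushforward_in_face[OF X L(1) prob_space_axioms _ meas]; use y in \<open>auto simp: s_def\<close>)+
    have j: "j x < n \<and> x \<in> B (j x)" if "x \<in> K" for x
    proof -
      obtain i where i: "i < n" "x \<in> B i" using KB[OF \<open>x \<in> K\<close>] by blast
      then have "j x \<le> i" unfolding j_def by (intro Least_le) simp
      moreover have "n \<le> j x \<or> x \<in> B (j x)" unfolding j_def by (rule LeastI[of _ i]) (simp add: i)
      ultimately show ?thesis using i by auto
    qed
    have "cmod (\<psi> f - \<phi> f) < \<epsilon> f" if f: "f \<in> J" for f
    proof -
      have fX: "f \<in> cfunspace X" using f J by blast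
      have int_f: "integrable M f"
        using X(1) reg cfunspace_continuous[OF fX] by (rule integrable_regular_borel_prob)
      have "AE x in M. cmod (f (s x) - f x) \<le> \<epsilon> f / 2"
        using AE_in_closed_if_supp_subset[OF reg K M(2)]
      proof eventually_elim
        fix x assume "x \<in> K"
        note j = j[OF this]
        then have "dist (f (p (j x))) (f x) < \<epsilon> f / 4" "dist (f (p (j x))) (f (s x)) < \<epsilon> f / 4"
          using y(2)[of "j x"] f by (auto simp: B_def C_def s_def)
        then show "cmod (f (s x) - f x) \<le> \<epsilon> f / 2"
          using dist_triangle2[of "f (s x)" "f x" "f (p (j x))"] by (simp add: dist_commute flip: dist_norm)
      qed
      then have "expectation (\<lambda>x. cmod (f (s x) - f x)) \<le> \<epsilon> f / 2"
        using int_f int_s[OF fX] by (intro integral_le_const) auto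
      moreover have "\<psi> f - \<phi> f = integral\<^sup>L M (\<lambda>x. f (s x) - f x)"
        using M(1) fX int_f int_s[OF fX] by (simp add: \<psi>_def represents_def)
      ultimately have "cmod (\<psi> f - \<phi> f) \<le> \<epsilon> f / 2"
        using integral_norm_bound[of M "\<lambda>x. f (s x) - f x"] by (metis order_trans)
      then show ?thesis using J(3)[OF f] by simp
    qed
    moreover have "\<psi> \<in> states X" using \<psi> by (simp add: face_def)
    ultimately have "\<psi> \<in> U" by (intro basic)
    then show "face X L \<inter> U \<noteq> {}" using \<psi> by blast
  qed
qed

section \<open>The embedding of the hyperspace\<close>

lemma face_in_closed_subsets:
  assumes X: "compact_space X" "Hausdorff_space X" and K: "K \<in> closed_subsets X"
  shows "face X K \<in> closed_subsets (state_space X)"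
proof -
  have cl: "closedin X K" and "K \<noteq> {}" using K by (auto simp: closed_subsets_def)
  then obtain x where "x \<in> K" by blast
  then have "dirac X x \<in> face X K"
    using dirac_in_face_iff[OF X cl, of x] closedin_subset[OF cl] by blast
  then show ?thesis using closedin_face[OF X cl] by (auto simp: closed_subsets_def)
qed

text \<open>
  The point evaluations in a face recover the closed set.
\<close>

lemma inj_on_face:
  assumes X: "compact_space X" "Hausdorff_space X"
  shows "inj_on (face X) (closed_subsets X)"
proof (rule inj_onI)
  have sub: "K \<subseteq> L" if "K \<in> closed_subsets X" "L \<in> closed_subsets X" "face X K = face X L" for K L
  proof
    fix x assume "x \<in> K"
    then show "x \<in> L"
      using that dirac_in_face_iff[OF X, of K x] dirac_in_face_iff[OF X, of L x]
      by (auto simp: closed_subsets_def dest: closedin_subset)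
  qed
  fix K L assume "K \<in> closed_subsets X" "L \<in> closed_subsets X" "face X K = face X L"
  then show "K = L" using sub[of K L] sub[of L K] by simp
qed

lemma continuous_map_face:
  assumes X: "compact_space X" "Hausdorff_space X"
  shows "continuous_map (hyperspace X) (hyperspace (state_space X)) (face X)"
proof (rule continuous_map_into_hyperspaceI)
  show "face X K \<in> closed_subsets (state_space X)" if "K \<in> topspace (hyperspace X)" for K
    using that face_in_closed_subsets[OF X] by (simp add: topspace_hyperspace)
next
  fix U K assume U: "openin (state_space X) U" and "K \<in> topspace (hyperspace X)" and meets: "face X K \<inter> U \<noteq> {}"
  then have K: "K \<in> closed_subsets X" "closedin X K" by (auto simp: topspace_hyperspace closed_subsets_def)
  obtain n :: nat and B where B: "\<And>i. i < n \<Longrightarrow> openin X (B i) \<and> K \<inter> B i \<noteq> {}"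
    and L: "\<And>L. closedin X L \<Longrightarrow> L \<noteq> {} \<Longrightarrow> (\<And>i. i < n \<Longrightarrow> L \<inter> B i \<noteq> {}) \<Longrightarrow> face X L \<inter> U \<noteq> {}"
    using face_meets_open_nbhd[OF X K(2) U meets] by blast
  let ?N = "(\<Inter>i\<in>{..<n}. vietoris_minus X (B i)) \<inter> topspace (hyperspace X)"
  have "openin (hyperspace X) ?N"
    using B by (intro openin_INT openin_hyperspace_minus) auto
  moreover have "K \<in> ?N" using K B by (auto simp: topspace_hyperspace vietoris_minus_def)
  moreover have "face X L' \<inter> U \<noteq> {}" if "L' \<in> ?N" for L'
    using that by (intro L) (auto simp: topspace_hyperspace closed_subsets_def vietoris_minus_def)
  ultimately show "\<exists>N. openin (hyperspace X) N \<and> K \<in> N \<and> (\<forall>L\<in>N. face X L \<inter> U \<noteq> {})" by blast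
next
  fix U K assume U: "openin (state_space X) U" and "K \<in> topspace (hyperspace X)" and sub: "face X K \<subseteq> U"
  then have K: "K \<in> closed_subsets X" "closedin X K" by (auto simp: topspace_hyperspace closed_subsets_def)
  obtain V where V: "openin X V" "K \<subseteq> V" "\<And>L. closedin X L \<Longrightarrow> L \<subseteq> V \<Longrightarrow> face X L \<subseteq> U"
    using face_subset_open_nbhd[OF X K(2) U sub] by blast
  then show "\<exists>N. openin (hyperspace X) N \<and> K \<in> N \<and> (\<forall>L\<in>N. face X L \<subseteq> U)"
    using K openin_hyperspace_plus[OF V(1)]
    by (intro exI[of _ "vietoris_plus X V"]) (auto simp: vietoris_plus_def closed_subsets_def)
qed

theorem proposition1:
  fixes X :: "'a topology"
  assumes "compact_space X" and "Hausdorff_space X"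
  shows "homeomorphic_map (hyperspace X)
           (subtopology (hyperspace (state_space X)) (face X ` closed_subsets X)) (face X)
       \<and> closedin (hyperspace (state_space X)) (face X ` closed_subsets X)"
proof
  let ?HX = "hyperspace X" and ?HS = "hyperspace (state_space X)"
  have cont: "continuous_map ?HX ?HS (face X)"
    using assms by (rule continuous_map_face)
  have compact: "compact_space ?HX"
    using assms(1) by (rule compact_space_hyperspace)
  have Hausdorff: "Hausdorff_space ?HS"
    by (intro Hausdorff_space_hyperspace compact_Hausdorff_imp_regular_space
        compact_space_state_space Hausdorff_space_state_space assms)
  have closed: "closed_map ?HX ?HS (face X)"
    using compact cont Hausdorff by (intro continuous_imp_closed_map)
  have inj: "inj_on (face X) (topspace ?HX)"
    using inj_on_face[OF assms] by (simp add: topspace_hyperspace)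
  show "homeomorphic_map ?HX (subtopology ?HS (face X ` closed_subsets X)) (face X)"
    using injective_closed_imp_embedding_map[OF cont closed inj]
    by (simp add: embedding_map_def topspace_hyperspace)
  show "closedin ?HS (face X ` closed_subsets X)"
    using closed unfolding closed_map_def topspace_hyperspace[symmetric] by blast
qed

end
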